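(* Let $(V,\circ,e)$ be a finite-dimensional Euclidean Jordan algebra over $\mathbb{R}$ with identity and rank $r$, let $\Omega$ be the interior of its cone of squares, and let $P:V\to V$ be the orthogonal projection onto a linear subspace of $V$. If the basic procedure is implemented via the Von Neumann Scheme (described in the context), then one of the stopping conditions $Pz\in\Omega$ or $\|(Pz)^+\|_F\le\frac1{4r}\|z\|$ is reached after at most $(4r^2)^2=16r^4$ iterations. In the special case $V=\mathbb{R}^n$, $\Omega=\mathbb{R}^n_{++}$, with the stopping conditions in the scheme replaced by $Pz>0$ or $\|(Pz)^+\|_2\le\frac1{3\sqrt n}\|z\|_\infty$, one of these two stopping conditions is reached after at most $(3n\sqrt n)^2=9n^3$ iterations.
   Context: Euclidean Jordan algebra: $\circ:V\times V\to V$ is bilinear and commutative, $x\circ(x^2\circ y)=x^2\circ(x\circ y)$ with $x^2=x\circ x$, $x\circ e=x$, and there is an associative positive definite bilinear form on $V$. The rank $r$ is the smallest integer such that $\{e,x,\dots,x^r\}$ is linearly dependent for all $x\in V$. Every $x\in V$ has a spectral decomposition $x=\sum_{i=1}^r\lambda_i(x)c_i$ with $\{c_1,\dots,c_r\}$ a Jordan frame (non-zero primitive idempotents, $c_i\circ c_j=0$ for $i\ne j$, $\sum_i c_i=e$). Put $\mathrm{trace}(x)=\sum_i\lambda_i(x)$. $V$ carries the inner product $\langle x,y\rangle=\mathrm{trace}(x\circ y)$; $\|x\|_F=\sqrt{\langle x,x\rangle}=\|\lambda(x)\|_2$ and $\|x\|=\|\lambda(x)\|_\infty$. $\Omega=\mathrm{int}\{x^2:x\in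 V\}$, $\bar\Omega$ is its closure, and $v^+$ is the orthogonal projection of $v$ onto $\bar\Omega$, i.e. $v^+=\sum_i\max\{\lambda_i(v),0\}c_i$. The spectraplex is $\Delta(\Omega)=\{x\in\bar\Omega:\langle e,x\rangle=1\}$. For $V=\mathbb{R}^n$ the product is componentwise, so $e$ is the all-ones vector, $r=n$, $\|\cdot\|_F=\|\cdot\|_2$, $\|\cdot\|=\|\cdot\|_\infty$ and $v^+=\max(v,0)$ componentwise. For $v\in V$, $u(v)\in\Delta(\Omega)$ denotes a (chosen) minimizer of $\langle u,v\rangle$ over $u\in\Delta(\Omega)$. Von Neumann Scheme: pick any $z_0\in\Delta(\Omega)$ and set $t=0$. While $Pz_t\notin\Omega$ and $\|(Pz_t)^+\|_F>\frac1{4r}\|z_t\|$: let $u=u(Pz_t)$, let $z_{t+1}=z_t+\theta_t(u-z_t)$ where $$\theta_t=\operatorname{argmin}_{\theta\in[0,1]}\|P(z_t+\theta(u-z_t))\|_F^2=\frac{\|Pz_t\|_F^2-\langle u,Pz_t\rangle}{\|Pz_t\|_F^2+\|Pu\|_F^2-2\langle u,Pz_t\rangle},$$ and increase $t$ by 1. Each execution of the loop body is one iteration. *)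

theory Defs
  imports "HOL-Analysis.Analysis" "HOL-Library.While_Combinator"
begin

text \<open>
  The type \<open>'a\<close> is the finite-dimensional (non-zero) real vector space underlying the
  algebra. Its type-class inner product is arbitrary and serves only to provide the topology for
  \<^const>\<open>interior\<close> and \<^const>\<open>closure\<close>, which does not depend on that choice; all geometry below
  is that of the trace inner product \<open>jinner\<close>.
\<close>

locale jordan_product =
  fixes jp :: "'a::euclidean_space \<Rightarrow> 'a \<Rightarrow> 'a"  (infixl "\<odot>" 70)
    and e :: 'a
begin

primrec jpow :: "'a \<Rightarrow> nat \<Rightarrow> 'a" where
  "jpow x 0 = e"
| "jpow x (Suc k) = x \<odot> jpow x k"

text \<open>Dependence of \<open>e, x, \<dots>, x\<^sup>m\<close> is meant as a family: the powers need not be distinct.\<close>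

definition powers_dependent :: "'a \<Rightarrow> nat \<Rightarrow> bool" where
  "powers_dependent x m \<longleftrightarrow>
     (\<exists>a :: nat \<Rightarrow> real. (\<exists>k\<le>m. a k \<noteq> 0) \<and> (\<Sum>k\<le>m. a k *\<^sub>R jpow x k) = 0)"

definition jrank :: nat where
  "jrank = (LEAST m. \<forall>x. powers_dependent x m)"

definition idempotent :: "'a \<Rightarrow> bool" where
  "idempotent c \<longleftrightarrow> c \<odot> c = c"

definition primitive_idempotent :: "'a \<Rightarrow> bool" where
  "primitive_idempotent c \<longleftrightarrow> c \<noteq> 0 \<and> idempotent c \<and>
     \<not> (\<exists>a b. a \<noteq> 0 \<and> b \<noteq> 0 \<and> idempotent a \<and> idempotent b \<and> c = a + b)"

definition jordan_frame :: "(nat \<Rightarrow> 'a) \<Rightarrow> bool" where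
  "jordan_frame c \<longleftrightarrow> (\<forall>i<jrank. primitive_idempotent (c i)) \<and>
     (\<forall>i<jrank. \<forall>j<jrank. i \<noteq> j \<longrightarrow> c i \<odot> c j = 0) \<and> (\<Sum>i<jrank. c i) = e"

definition spectral_decomposition :: "'a \<Rightarrow> (nat \<Rightarrow> real) \<Rightarrow> (nat \<Rightarrow> 'a) \<Rightarrow> bool" where
  "spectral_decomposition x l c \<longleftrightarrow> jordan_frame c \<and> x = (\<Sum>i<jrank. l i *\<^sub>R c i)"

text \<open>
  In a Euclidean Jordan algebra a spectral decomposition exists and its coefficients are unique up
  to order. Only symmetric functions of \<open>eigenvalues x 0, \<dots>, eigenvalues x (r - 1)\<close> are used.
\<close>

definition eigenvalues :: "'a \<Rightarrow> nat \<Rightarrow> real" where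
  "eigenvalues x = (SOME l. \<exists>c. spectral_decomposition x l c)"

definition jtrace :: "'a \<Rightarrow> real" where
  "jtrace x = (\<Sum>i<jrank. eigenvalues x i)"

definition jinner :: "'a \<Rightarrow> 'a \<Rightarrow> real" where
  "jinner x y = jtrace (x \<odot> y)"

definition frob_norm :: "'a \<Rightarrow> real" where
  "frob_norm x = sqrt (jinner x x)"

definition spec_norm :: "'a \<Rightarrow> real" where
  "spec_norm x = Max ((\<lambda>i. \<bar>eigenvalues x i\<bar>) ` {..<jrank})"

definition Omega :: "'a set" where
  "Omega = interior {x \<odot> x | x. True}"

text \<open>The analogue of \<^const>\<open>closest_point\<close> for the trace inner product.\<close>

definition pos_part :: "'a \<Rightarrow> 'a" where
  "pos_part v = arg_min_on (\<lambda>w. frob_norm (v - w)) (closure Omega)"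

definition spectraplex :: "'a set" where
  "spectraplex = {x \<in> closure Omega. jinner e x = 1}"

definition orthogonal_projection_onto :: "'a set \<Rightarrow> ('a \<Rightarrow> 'a) \<Rightarrow> bool" where
  "orthogonal_projection_onto L P \<longleftrightarrow>
     subspace L \<and> (\<forall>x. P x \<in> L \<and> (\<forall>y\<in>L. jinner (x - P x) y = 0))"

definition spectraplex_minimizer :: "('a \<Rightarrow> 'a) \<Rightarrow> bool" where
  "spectraplex_minimizer u \<longleftrightarrow>
     (\<forall>v. is_arg_min (\<lambda>w. jinner w v) (\<lambda>w. w \<in> spectraplex) (u v))"

definition step_size :: "('a \<Rightarrow> 'a) \<Rightarrow> 'a \<Rightarrow> 'a \<Rightarrow> real" where
  "step_size P z w = arg_min_on (\<lambda>\<theta>. (frob_norm (P (z + \<theta> *\<^sub>R (w - z))))\<^sup>2) {0..1}"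

text \<open>
  The loop state is the current point together with the number of executed iterations; the value is
  \<^const>\<open>None\<close> if the loop does not terminate.
\<close>

definition von_neumann_scheme ::
  "('a \<Rightarrow> 'a) \<Rightarrow> ('a \<Rightarrow> 'a) \<Rightarrow> ('a \<Rightarrow> bool) \<Rightarrow> 'a \<Rightarrow> ('a \<times> nat) option" where
  "von_neumann_scheme P u stop z0 =
     while_option (\<lambda>(z, t). \<not> stop z)
       (\<lambda>(z, t). let w = u (P z) in (z + step_size P z w *\<^sub>R (w - z), t + 1))
       (z0, 0)"

definition stopping :: "('a \<Rightarrow> 'a) \<Rightarrow> 'a \<Rightarrow> bool" where
  "stopping P z \<longleftrightarrow>
     P z \<in> Omega \<or> frob_norm (pos_part (P z)) \<le> 1 / (4 * real jrank) * spec_norm z"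

end

text \<open>Symmetry of the form \<open>B\<close> follows from associativity, commutativity and the unit law.\<close>

locale euclidean_jordan_algebra = jordan_product jp e
  for jp :: "'a::euclidean_space \<Rightarrow> 'a \<Rightarrow> 'a"  (infixl "\<odot>" 70) and e :: 'a +
  assumes bilinear_jp: "bilinear (\<odot>)"
    and jp_commute: "x \<odot> y = y \<odot> x"
    and jordan_identity: "x \<odot> ((x \<odot> x) \<odot> y) = (x \<odot> x) \<odot> (x \<odot> y)"
    and jp_unit: "x \<odot> e = x"
    and ex_associative_form:
      "\<exists>B :: 'a \<Rightarrow> 'a \<Rightarrow> real. bilinear B \<and>
         (\<forall>x y z. B (x \<odot> y) z = B x (y \<odot> z)) \<and> (\<forall>x. x \<noteq> 0 \<longrightarrow> 0 < B x x)"

definition orthant_stopping :: "(real ^ 'n \<Rightarrow> real ^ 'n) \<Rightarrow> real ^ 'n \<Rightarrow> bool" where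
  "orthant_stopping P z \<longleftrightarrow> (\<forall>i. 0 < P z $ i) \<or>
     norm (\<chi> i. max (P z $ i) 0) \<le> 1 / (3 * sqrt (real CARD('n))) * infnorm z"

text \<open>The algebra of componentwise multiplication; its unit is the all-ones vector.\<close>

abbreviation cw_mult :: "real ^ 'n \<Rightarrow> real ^ 'n \<Rightarrow> real ^ 'n" where
  "cw_mult x y \<equiv> \<chi> i. x $ i * y $ i"

abbreviation ones :: "real ^ 'n" where
  "ones \<equiv> \<chi> i. 1"

end

theory Submission
  imports Defs
begin

text \<open>
  In the algebra generated by \<open>x\<close> every eigenvector of multiplication by \<open>x\<close> is a multiple of an
  idempotent; splitting off primitive idempotents repeatedly yields spectral decompositions. Two
  primitive idempotents that are not orthogonal have the same length in any associative positive
  definite form \<open>B\<close>. Hence rescaling \<open>B\<close> gives a linear functional that is 1 on all primitive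
  idempotents: this is the trace, and it is associative.

  For the scheme, if \<open>P z \<notin> \<Omega>\<close> then some primitive idempotent shows that \<open>u = u(P z)\<close> satisfies
  \<open>\<langle>u, P z\<rangle> \<le> 0\<close>, so that \<open>1 / \<parallel>P z\<^sub>t\<parallel>\<^sup>2\<close> grows by at least 1 in each iteration. As long as the stopping
  condition fails, \<open>\<parallel>P z\<parallel> \<ge> \<parallel>(P z)\<^sup>+\<parallel>\<close> is bounded below, because some eigenvalue of \<open>z\<close> is at least \<open>1 / r\<close>.
\<close>

subsection \<open>Power associativity and Peirce spaces\<close>

context euclidean_jordan_algebra
begin

lemmas jp_simps =
  bilinear_ladd[OF bilinear_jp] bilinear_radd[OF bilinear_jp]
  bilinear_lsub[OF bilinear_jp] bilinear_rsub[OF bilinear_jp]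
  bilinear_lmul[OF bilinear_jp] bilinear_rmul[OF bilinear_jp]
  bilinear_lneg[OF bilinear_jp] bilinear_rneg[OF bilinear_jp]
  bilinear_lzero[OF bilinear_jp] bilinear_rzero[OF bilinear_jp]

lemma linear_jp: "linear (\<lambda>y. x \<odot> y)"
  using bilinear_jp by (simp add: bilinear_def)

lemma jp_sum_right: "x \<odot> (\<Sum>i\<in>I. f i) = (\<Sum>i\<in>I. x \<odot> f i)"
  using linear_sum[OF linear_jp] .

lemma jp_sum_left: "(\<Sum>i\<in>I. f i) \<odot> x = (\<Sum>i\<in>I. f i \<odot> x)"
  by (simp add: jp_commute[of _ x] jp_sum_right)

lemma unit_nonzero: "e \<noteq> 0"
proof
  assume "e = 0"
  then have "x = 0" for x :: 'a
    using jp_unit[of x] by (simp add: jp_simps)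
  then show False
    using nonzero_Basis SOME_Basis by metis
qed

text \<open>Polarization: subtracting the Jordan identities at \<open>x + z\<close> and
  \<open>x - z\<close> keeps the parts odd in \<open>z\<close>, and the part cubic in
  \<open>z\<close> cancels by the identity itself.\<close>

lemma linearized_jordan_identity:
  "z \<odot> ((x \<odot> x) \<odot> y) + 2 *\<^sub>R (x \<odot> ((x \<odot> z) \<odot> y)) =
     2 *\<^sub>R ((x \<odot> z) \<odot> (x \<odot> y)) + (x \<odot> x) \<odot> (z \<odot> y)"
proof -
  have zx: "z \<odot> x = x \<odot> z" by (rule jp_commute)
  have p: "(x + z) \<odot> (((x + z) \<odot> (x + z)) \<odot> y) = ((x + z) \<odot> (x + z)) \<odot> ((x + z) \<odot> y)"
    by (rule jordan_identity)
  have m: "(x - z) \<odot> (((x - z) \<odot> (x - z)) \<odot> y) = ((x - z) \<odot> (x - z)) \<odot> ((x - z) \<odot> y)"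
    by (rule jordan_identity)
  have "2 *\<^sub>R (z \<odot> ((x \<odot> x) \<odot> y) + 2 *\<^sub>R (x \<odot> ((x \<odot> z) \<odot> y)) + z \<odot> ((z \<odot> z) \<odot> y)) =
     2 *\<^sub>R (2 *\<^sub>R ((x \<odot> z) \<odot> (x \<odot> y)) + (x \<odot> x) \<odot> (z \<odot> y) + (z \<odot> z) \<odot> (z \<odot> y))"
    using arg_cong2[where f = minus, OF p m]
    by (simp add: jp_simps zx algebra_simps scaleR_2)
  then show ?thesis
    by (simp add: jordan_identity)
qed

text \<open>The linearized identity solved for one term, so that multiplication by
  \<open>(x \<odot> x) \<odot> y\<close> is built from those by \<open>x\<close>, \<open>y\<close>,
  \<open>x \<odot> x\<close> and \<open>x \<odot> y\<close>. For \<open>y\<close> a power of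
  \<open>x\<close> this is a recursion.\<close>

lemma jp_square_mult:
  "((x \<odot> x) \<odot> y) \<odot> z =
     (x \<odot> x) \<odot> (y \<odot> z) + 2 *\<^sub>R ((x \<odot> y) \<odot> (x \<odot> z)) - 2 *\<^sub>R (x \<odot> (y \<odot> (x \<odot> z)))"
  using linearized_jordan_identity[of z x y]
  by (simp add: jp_commute algebra_simps)

lemma square_jp_jpow: "(x \<odot> x) \<odot> jpow x n = jpow x (n + 2)"
  by (induction n) (simp_all add: jp_unit jordan_identity[symmetric])

text \<open>By that recursion multiplication by a power of \<open>x\<close> is built from
  \<open>x\<close>, \<open>x \<odot> x\<close> and the two previous powers, all of which commute
  with multiplication by \<open>x\<close>.\<close>

lemma jpow_mult_commute: "jpow x n \<odot> (x \<odot> y) = x \<odot> (jpow x n \<odot> y)"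
proof (induction n arbitrary: y rule: induct_nat_012)
  case 0
  then show ?case by (simp add: jp_commute[of e] jp_unit)
next
  case 1
  then show ?case by (simp add: jp_unit)
next
  case (ge2 n)
  have "jpow x (Suc (Suc n)) \<odot> w = (x \<odot> x) \<odot> (jpow x n \<odot> w)
      + 2 *\<^sub>R (jpow x (Suc n) \<odot> (x \<odot> w)) - 2 *\<^sub>R (x \<odot> (jpow x n \<odot> (x \<odot> w)))" for w
    using jp_square_mult[of x "jpow x n" w] square_jp_jpow[of x n] by simp
  then show ?case
    using ge2 by (simp add: jp_simps jordan_identity del: jpow.simps)
qed

lemma jpow_add: "jpow x m \<odot> jpow x n = jpow x (m + n)"
  by (induction n) (simp_all add: jp_unit jpow_mult_commute)

text \<open>The recursion at \<open>x = y = c\<close>. The polynomial is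
  \<open>t (t - 1) (2 t - 1)\<close>, so multiplication by \<open>c\<close> has only the eigenvalues
  0, 1/2 and 1.\<close>

lemma peirce_polynomial:
  assumes "idempotent c"
  shows "2 *\<^sub>R (c \<odot> (c \<odot> (c \<odot> y))) = 3 *\<^sub>R (c \<odot> (c \<odot> y)) - c \<odot> y"
proof -
  have "c \<odot> c = c" using assms by (simp add: idempotent_def)
  then have "c \<odot> y = c \<odot> (c \<odot> y) + 2 *\<^sub>R (c \<odot> (c \<odot> y)) - 2 *\<^sub>R (c \<odot> (c \<odot> (c \<odot> y)))"
    using jp_square_mult[of c c y] by simp
  moreover have "c \<odot> (c \<odot> y) + 2 *\<^sub>R (c \<odot> (c \<odot> y)) = 3 *\<^sub>R (c \<odot> (c \<odot> y))"
    using scaleR_add_left[of 1 2 "c \<odot> (c \<odot> y)"] by simp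
  ultimately show ?thesis by (simp add: algebra_simps)
qed

lemma peirce_1_1:
  assumes "idempotent c" "c \<odot> y = y" "c \<odot> z = z"
  shows "c \<odot> (y \<odot> z) = y \<odot> z"
proof -
  have "z \<odot> y + 2 *\<^sub>R (c \<odot> (z \<odot> y)) = 2 *\<^sub>R (z \<odot> y) + c \<odot> (z \<odot> y)"
    using linearized_jordan_identity[of z c y] assms by (simp add: idempotent_def)
  then show ?thesis by (simp add: scaleR_2 jp_commute)
qed

text \<open>One instance of the linearized identity shows that \<open>c\<close> fixes
  \<open>y \<odot> z\<close>; the instance with \<open>y\<close> and \<open>z\<close> exchanged
  shows that \<open>c\<close> annihilates it.\<close>

lemma peirce_0_1:
  assumes "idempotent c" "c \<odot> y = y" "c \<odot> z = 0"
  shows "y \<odot> z = 0"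
proof -
  have "z \<odot> y = c \<odot> (z \<odot> y)"
    using linearized_jordan_identity[of z c y] assms by (simp add: idempotent_def jp_simps)
  moreover have "2 *\<^sub>R (c \<odot> (y \<odot> z)) = c \<odot> (y \<odot> z)"
    using linearized_jordan_identity[of y c z] assms by (simp add: idempotent_def jp_simps)
  ultimately show ?thesis by (simp add: scaleR_2 jp_commute)
qed

section \<open>Splitting idempotents\<close>

lemma idempotent_diff:
  assumes "idempotent c" "idempotent g" "c \<odot> g = g"
  shows "idempotent (c - g)"
  using assms jp_commute[of g c] by (simp add: idempotent_def jp_simps)

text \<open>This holds because \<open>c - g\<close> lies in the Peirce 0-space of \<open>g\<close>.\<close>

lemma peirce_1_trans:
  assumes "idempotent g" "c \<odot> g = g" "g \<odot> y = y"
  shows "c \<odot> y = y"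
proof -
  have "g \<odot> (c - g) = 0"
    using assms jp_commute[of g c] by (simp add: idempotent_def jp_simps)
  from peirce_0_1[OF assms(1,3) this] show ?thesis
    using assms jp_commute[of y] by (simp add: jp_simps)
qed

text \<open>Induction measure for splitting off idempotents: it drops strictly on passing to a
  proper part of \<open>c\<close>.\<close>

definition peirce_dim :: "'a \<Rightarrow> nat" where
  "peirce_dim c = dim {y. c \<odot> y = y}"

lemma subspace_peirce_1: "subspace {y. c \<odot> y = y}"
  by (auto simp: subspace_def jp_simps)

lemma peirce_dim_less:
  assumes "idempotent g" "c \<odot> g = g" "c \<odot> w = w" "g \<odot> w \<noteq> w"
  shows "peirce_dim g < peirce_dim c"
proof -
  have "{y. g \<odot> y = y} \<subset> {y. c \<odot> y = y}"
    using assms peirce_1_trans by blast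
  then show ?thesis
    unfolding peirce_dim_def
    by (metis dim_psubset span_eq_iff subspace_peirce_1)
qed

text \<open>Descent on \<open>peirce_dim\<close>: a splitting \<open>c = a + b\<close> into
  idempotents forces \<open>a \<odot> b = 0\<close>, so \<open>b\<close> lies in the Peirce 1-space
  of \<open>c\<close> but not in that of \<open>a\<close>.\<close>

lemma primitive_idempotent_exists:
  assumes "idempotent c" "c \<noteq> 0"
  shows "\<exists>p. primitive_idempotent p \<and> c \<odot> p = p"
  using assms
proof (induction "peirce_dim c" arbitrary: c rule: less_induct)
  case less
  show ?case
  proof (cases "primitive_idempotent c")
    case True
    then show ?thesis using less.prems by (auto simp: idempotent_def)
  next
    case False
    then obtain a b where ab: "a \<noteq> 0" "b \<noteq> 0" "idempotent a" "idempotent b" "c = a + b"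
      using less.prems by (auto simp: primitive_idempotent_def)
    have "2 *\<^sub>R (a \<odot> b) = 0"
      using less.prems(1) ab jp_commute[of b a]
      by (simp add: idempotent_def jp_simps scaleR_2 algebra_simps)
    then have "a \<odot> b = 0" by simp
    then have c: "c \<odot> a = a" "c \<odot> b = b" "a \<odot> b \<noteq> b"
      using ab jp_commute[of b a] by (auto simp: idempotent_def jp_simps)
    obtain p where "primitive_idempotent p" "a \<odot> p = p"
      using less.hyps[OF peirce_dim_less[OF ab(3) c] ab(3,1)] by blast
    then show ?thesis using peirce_1_trans[OF ab(3) c(1)] by blast
  qed
qed

end

subsection \<open>Associative forms and spectral decompositions\<close>

text \<open>First-order optimality condition. If \<open>q\<close> were nonzero, the value at
  \<open>t = - q / s\<close> would be negative for every positive \<open>s > r / 2\<close>.\<close>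

lemma linear_coefficient_zero:
  fixes q r :: real
  assumes "\<And>t. 0 \<le> 2 * t * q + t\<^sup>2 * r"
  shows "q = 0"
proof (rule ccontr)
  assume q: "q \<noteq> 0"
  define s where "s = \<bar>r\<bar> + 1"
  have s: "s > 0" "r < 2 * s" by (auto simp: s_def)
  have "2 * (- q / s) * q + (- q / s)\<^sup>2 * r = q\<^sup>2 * (r - 2 * s) / s\<^sup>2"
    using s by (simp add: field_simps power2_eq_square)
  also have "\<dots> < 0"
    using s q by (intro divide_neg_pos mult_pos_neg) auto
  finally show False using assms[of "- q / s"] by simp
qed

locale associative_form = euclidean_jordan_algebra jp e
  for jp :: "'a::euclidean_space \<Rightarrow> 'a \<Rightarrow> 'a"  (infixl "\<odot>" 70) and e :: 'a +
  fixes B :: "'a \<Rightarrow> 'a \<Rightarrow> real"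
  assumes bilinear_form: "bilinear B"
    and form_assoc: "B (x \<odot> y) z = B x (y \<odot> z)"
    and form_pos: "x \<noteq> 0 \<Longrightarrow> 0 < B x x"
begin

lemmas form_simps =
  bilinear_ladd[OF bilinear_form] bilinear_radd[OF bilinear_form]
  bilinear_lsub[OF bilinear_form] bilinear_rsub[OF bilinear_form]
  bilinear_lmul[OF bilinear_form] bilinear_rmul[OF bilinear_form]
  bilinear_lneg[OF bilinear_form] bilinear_rneg[OF bilinear_form]
  bilinear_lzero[OF bilinear_form] bilinear_rzero[OF bilinear_form]

lemma linear_form: "linear (\<lambda>y. B x y)"
  using bilinear_form by (simp add: bilinear_def)

lemma form_sum_left: "B (\<Sum>i\<in>I. f i) x = (\<Sum>i\<in>I. B (f i) x)"
  using linear_sum[of "\<lambda>y. B y x"] bilinear_form by (simp add: bilinear_def)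

lemma form_unit: "B e (x \<odot> y) = B x y"
  using form_assoc[of e x y] by (simp add: jp_commute[of e] jp_unit)

lemma form_commute: "B x y = B y x"
  using form_unit[of x y] form_unit[of y x] by (simp add: jp_commute[of y x])

lemma form_adjoint: "B (x \<odot> y) z = B y (x \<odot> z)"
  using form_assoc[of y x z] by (simp add: jp_commute[of y x])

lemma form_eq_0_iff: "B x x = 0 \<longleftrightarrow> x = 0"
  using form_pos[of x] by (cases "x = 0") (auto simp: form_simps)

lemma form_nonneg: "0 \<le> B x x"
  using form_pos[of x] form_eq_0_iff[of x] by (cases "x = 0") auto

lemma form_Cauchy_Schwarz_unit:
  assumes "B y y = 1"
  shows "(B x y)\<^sup>2 \<le> B x x"
  using form_nonneg[of "x - B x y *\<^sub>R y"] assms form_commute[of y x]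
  by (simp add: form_simps power2_eq_square algebra_simps)

lemma continuous_on_form [continuous_intros]:
  assumes "continuous_on S f" "continuous_on S g"
  shows "continuous_on S (\<lambda>x. B (f x) (g x))"
  using bounded_bilinear.continuous_on[OF bilinear_form[unfolded bilinear_conv_bounded_bilinear] assms] .

lemma idempotent_nonneg:
  assumes "idempotent c"
  shows "0 \<le> B (c \<odot> w) w" and "B (c \<odot> w) w = 0 \<Longrightarrow> c \<odot> w = 0"
proof -
  \<comment> \<open>\<open>p\<close> is the component of \<open>w\<close> in the Peirce 1-space and
    \<open>4 q\<close> the one in the 1/2-space. Multiplication by \<open>c\<close> weights their
    squared lengths by 1 and 1/2, whence the factor 8 below.\<close>
  define p where "p = 2 *\<^sub>R (c \<odot> (c \<odot> w)) - c \<odot> w"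
  define q where "q = c \<odot> w - c \<odot> (c \<odot> w)"
  have c3: "c \<odot> (c \<odot> (c \<odot> w)) = (3/2) *\<^sub>R (c \<odot> (c \<odot> w)) - (1/2) *\<^sub>R (c \<odot> w)"
    using arg_cong[OF peirce_polynomial[OF assms, of w], of "\<lambda>v. (1/2) *\<^sub>R v"]
    by (simp add: algebra_simps)
  have m: "B (c \<odot> w) w = B p p + 8 * B q q"
    unfolding p_def q_def
    by (simp add: form_simps form_adjoint jp_simps c3 algebra_simps)
  show "0 \<le> B (c \<odot> w) w"
    unfolding m using form_nonneg[of p] form_nonneg[of q] by simp
  assume "B (c \<odot> w) w = 0"
  then have "p = 0" "q = 0"
    using m form_nonneg[of p] form_nonneg[of q] form_eq_0_iff by force+
  then show "c \<odot> w = 0"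
    unfolding p_def q_def by (simp add: scaleR_2)
qed

lemma idempotent_form_square: "idempotent c \<Longrightarrow> 0 \<le> B (w \<odot> w) c"
  using idempotent_nonneg(1)[of c w] jp_commute[of w c] by (simp add: form_adjoint)

text \<open>Equality case of \<open>idempotent_nonneg\<close> at \<open>w = d\<close>, because
  \<open>B (c \<odot> d) d = B c d\<close>.\<close>

lemma idempotent_orthogonal:
  assumes "idempotent c" "idempotent d" "B c d = 0"
  shows "c \<odot> d = 0"
proof -
  have "B (c \<odot> d) d = B c d"
    using assms(2) by (simp add: form_assoc idempotent_def)
  then show ?thesis using idempotent_nonneg(2)[OF assms(1)] assms(3) by simp
qed

text \<open>A maximizer of the Rayleigh quotient of \<open>y \<mapsto> x \<odot> y\<close> on an invariant subspace is an
  eigenvector.\<close>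

lemma eigenvector_exists:
  assumes A: "subspace A" "\<And>y. y \<in> A \<Longrightarrow> x \<odot> y \<in> A" and a0: "a0 \<in> A" "a0 \<noteq> 0"
  shows "\<exists>a\<in>A. a \<noteq> 0 \<and> (\<exists>l. x \<odot> a = l *\<^sub>R a)"
proof -
  \<comment> \<open>The quotient is scale invariant, so it suffices to maximize over the compact
    unit sphere of the type-class norm.\<close>
  let ?S = "A \<inter> sphere 0 1"
  let ?R = "\<lambda>a. B (x \<odot> a) a / B a a"
  have "compact ?S"
    using closed_subspace[OF A(1)] by (intro closed_Int_compact) auto
  moreover have "inverse (norm a0) *\<^sub>R a0 \<in> ?S"
    using a0 A(1) by (auto simp: subspace_scale)
  moreover have "continuous_on ?S ?R"
    by (intro continuous_intros linear_continuous_on linear_jp[THEN linear_conv_bounded_linear[THEN iffD1]])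
       (auto simp: form_eq_0_iff)
  ultimately obtain a where a: "a \<in> ?S" "\<And>y. y \<in> ?S \<Longrightarrow> ?R y \<le> ?R a"
    using continuous_attains_sup[of ?S ?R] by blast
  define l where "l = ?R a"
  have "a \<noteq> 0" using a(1) by auto
  have Q: "0 \<le> l * B v v - B (x \<odot> v) v" if "v \<in> A" for v
  proof (cases "v = 0")
    case False
    have "inverse (norm v) *\<^sub>R v \<in> ?S"
      using that False A(1) by (auto simp: subspace_scale)
    from a(2)[OF this] have "?R v \<le> l"
      using False by (simp add: l_def form_simps jp_simps)
    then show ?thesis
      using form_pos[OF False] by (simp add: field_simps)
  qed (simp add: form_simps jp_simps)
  \<comment> \<open>The residual of the eigenvalue equation serves as test direction: the linear
    coefficient along it is \<open>B h h\<close>.\<close>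
  define h where "h = l *\<^sub>R a - x \<odot> a"
  have "h \<in> A" using a(1) A by (auto simp: h_def subspace_diff subspace_scale)
  have sym: "B (x \<odot> h) a = B (x \<odot> a) h"
    using form_commute[of h] by (simp add: form_adjoint)
  have Qa: "l * B a a - B (x \<odot> a) a = 0"
    using \<open>a \<noteq> 0\<close> by (simp add: l_def form_eq_0_iff)
  have "0 \<le> 2 * t * (l * B a h - B (x \<odot> a) h) + t\<^sup>2 * (l * B h h - B (x \<odot> h) h)" for t
  proof -
    have "a + t *\<^sub>R h \<in> A"
      using a(1) \<open>h \<in> A\<close> A(1) by (auto simp: subspace_add subspace_scale)
    from Q[OF this] show ?thesis
      using Qa sym form_commute[of h a]
      by (simp add: form_simps jp_simps algebra_simps power2_eq_square)
  qed
  then have "l * B a h - B (x \<odot> a) h = 0"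
    by (rule linear_coefficient_zero)
  then have "B h h = 0"
    by (subst (1) h_def) (simp add: form_simps)
  then have "x \<odot> a = l *\<^sub>R a"
    by (simp add: form_eq_0_iff h_def)
  then show ?thesis using a(1) \<open>a \<noteq> 0\<close> by blast
qed

text \<open>The eigenvector is taken in the span of the positive powers of \<open>x\<close>; on this associative
  algebra it spans an ideal, so a multiple of it is idempotent.\<close>

lemma eigen_idempotent_exists:
  assumes c: "idempotent c" "c \<odot> x = x" and "x \<noteq> 0"
  shows "\<exists>g l. idempotent g \<and> g \<noteq> 0 \<and> c \<odot> g = g \<and> x \<odot> g = l *\<^sub>R g"
proof -
  \<comment> \<open>Exponents start at 1, so that all of \<open>A\<close> lies in the Peirce 1-space
    of \<open>c\<close>, which need not contain \<open>e\<close>.\<close>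
  define A where "A = span {jpow x (Suc k) | k. True}"
  have pow_in: "jpow x (Suc k) \<in> A" for k
    unfolding A_def by (rule span_base) auto
  have mult_in: "x \<odot> y \<in> A" if "y \<in> A" for y
    using that unfolding A_def
  proof (induction rule: span_induct)
    case base
    show ?case by (auto simp: subspace_def jp_simps span_0 span_add span_scale)
  next
    case (step y)
    then show ?case
      using pow_in[of "Suc _"] by (auto simp: A_def)
  qed
  have "x \<in> A" using pow_in[of 0] by (simp add: jp_unit)
  then obtain a l where a: "a \<in> A" "a \<noteq> 0" "x \<odot> a = l *\<^sub>R a"
    using eigenvector_exists[of A x x] mult_in \<open>x \<noteq> 0\<close> by (auto simp: A_def)
  have pow_a: "jpow x (Suc k) \<odot> a = l ^ Suc k *\<^sub>R a" for k
  proof (induction k)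
    case 0
    then show ?case using a by (simp add: jp_unit)
  next
    case (Suc k)
    \<comment> \<open>Associativity against powers holds for powers of \<open>x\<close> and extends
      linearly to \<open>A\<close>; the case \<open>m = 1\<close> at \<open>a\<close> gives the next
      exponent.\<close>
    have "jpow x (Suc k + m) \<odot> y = jpow x m \<odot> (jpow x (Suc k) \<odot> y)" if "y \<in> A" for y m
      using that unfolding A_def
    proof (induction rule: span_induct)
      case base
      show ?case by (auto simp: subspace_def jp_simps)
    next
      case (step y)
      then show ?case by (auto simp: jpow_add ac_simps simp del: jpow.simps)
    qed
    from this[OF a(1), of 1] Suc a(3) show ?case
      by (simp add: jp_simps jp_unit)
  qed
  have "\<exists>m. y \<odot> a = m *\<^sub>R a" if "y \<in> A" for y
    using that unfolding A_def
  proof (induction rule: span_induct)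
    case base
    show ?case
      by (auto simp: subspace_def jp_simps intro: exI[of _ 0]) (metis scaleR_add_left)
  next
    case (step y)
    then show ?case using pow_a by auto
  qed
  then obtain m where m: "a \<odot> a = m *\<^sub>R a" using a(1) by blast
  \<comment> \<open>\<open>B e (a \<odot> a) = B a a\<close> is positive, so
    \<open>a \<odot> a\<close> cannot vanish.\<close>
  have "m \<noteq> 0"
    using m form_unit[of a a] form_pos[OF a(2)] by (auto simp: form_simps)
  define g where "g = inverse m *\<^sub>R a"
  have "c \<odot> y = y" if "y \<in> A" for y
    using that unfolding A_def
  proof (induction rule: span_induct)
    case base
    show ?case using subspace_peirce_1 .
  next
    case (step y)
    then obtain k where y: "y = jpow x (Suc k)" by blast
    have "c \<odot> jpow x (Suc k) = jpow x (Suc k)"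
      by (induction k) (use c peirce_1_1[OF c] in \<open>auto simp: jp_unit\<close>)
    then show ?case using y by simp
  qed
  then have "c \<odot> a = a" using a(1) .
  then show ?thesis
    using a m \<open>m \<noteq> 0\<close>
    by (intro exI[of _ g] exI[of _ l]) (auto simp: g_def idempotent_def jp_simps)
qed

lemma eigen_primitive_exists:
  assumes "idempotent c" "c \<noteq> 0" "c \<odot> x = x"
  shows "\<exists>p l. primitive_idempotent p \<and> c \<odot> p = p \<and> x \<odot> p = l *\<^sub>R p"
proof (cases "x = 0")
  case True
  then show ?thesis
    using primitive_idempotent_exists[OF assms(1,2)] by (auto simp: jp_simps intro: exI[of _ 0])
next
  case False
  obtain g l where g: "idempotent g" "g \<noteq> 0" "c \<odot> g = g" "x \<odot> g = l *\<^sub>R g"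
    using eigen_idempotent_exists[OF assms(1,3) False] by blast
  obtain p where p: "primitive_idempotent p" "g \<odot> p = p"
    using primitive_idempotent_exists[OF g(1,2)] by blast
  \<comment> \<open>The remainder lies in the Peirce 0-space of \<open>g\<close>, so it annihilates
    \<open>p\<close> and the eigenvalue passes from \<open>g\<close> to \<open>p\<close>.\<close>
  have "g \<odot> (x - l *\<^sub>R g) = 0"
    using g jp_commute[of g x] by (simp add: jp_simps idempotent_def)
  from peirce_0_1[OF g(1) p(2) this] have "x \<odot> p = l *\<^sub>R p"
    using p jp_commute[of p] by (simp add: jp_simps)
  then show ?thesis using p peirce_1_trans[OF g(1,3)] by blast
qed

text \<open>Stated relative to \<open>c\<close> so that induction applies: after splitting off a
  primitive eigenvector \<open>q\<close> of \<open>x\<close>, the element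
  \<open>x - m *\<^sub>R q\<close> lies in the Peirce 1-space of \<open>c - q\<close>, which is
  smaller.\<close>

lemma spectral_decomposition_peirce_1:
  assumes "idempotent c" "c \<odot> x = x"
  shows "\<exists>n p l. (\<forall>i<n. primitive_idempotent (p i) \<and> c \<odot> p i = p i) \<and>
     (\<forall>i<n. \<forall>j<n. i \<noteq> j \<longrightarrow> p i \<odot> p j = 0) \<and>
     (\<Sum>i<n. p i) = c \<and> (\<Sum>i<(n::nat). l i *\<^sub>R p i) = x"
  using assms
proof (induction "peirce_dim c" arbitrary: c x rule: less_induct)
  case less
  show ?case
  proof (cases "c = 0")
    case True
    then show ?thesis using less.prems by (intro exI[of _ 0]) (auto simp: jp_simps)
  next
    case False
    obtain q m where q: "primitive_idempotent q" "c \<odot> q = q" "x \<odot> q = m *\<^sub>R q"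
      using eigen_primitive_exists[OF less.prems(1) False less.prems(2)] by blast
    have idem: "idempotent q" "q \<noteq> 0" using q by (auto simp: primitive_idempotent_def)
    then have qq: "q \<odot> q = q" by (simp add: idempotent_def)
    have d: "idempotent (c - q)" by (rule idempotent_diff[OF less.prems(1) idem(1) q(2)])
    have d0: "(c - q) \<odot> q = 0" using q qq by (simp add: jp_simps)
    have dc: "c \<odot> (c - q) = c - q"
      using less.prems(1) q by (simp add: jp_simps idempotent_def)
    have dx: "(c - q) \<odot> (x - m *\<^sub>R q) = x - m *\<^sub>R q"
      using less.prems(2) q qq by (simp add: jp_simps jp_commute[of q x])
    have "peirce_dim (c - q) < peirce_dim c"
      by (rule peirce_dim_less[OF d dc q(2)]) (use d0 idem in auto)
    from less.hyps[OF this d dx] obtain n p l where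
      "\<forall>i<n. primitive_idempotent (p i) \<and> (c - q) \<odot> p i = p i"
      and p2: "\<forall>i<n. \<forall>j<n. i \<noteq> j \<longrightarrow> p i \<odot> p j = 0"
      and p3: "(\<Sum>i<n. p i) = c - q" "(\<Sum>i<(n::nat). l i *\<^sub>R p i) = x - m *\<^sub>R q"
      by (elim exE conjE)
    then have p: "\<And>i. i < n \<Longrightarrow> primitive_idempotent (p i)" "\<And>i. i < n \<Longrightarrow> (c - q) \<odot> p i = p i"
      by simp_all
    have orth: "p i \<odot> q = 0" "q \<odot> p i = 0" if "i < n" for i
      using peirce_0_1[OF d p(2)[OF that] d0] jp_commute[of q] by simp_all
    have cp: "c \<odot> p i = p i" if "i < n" for i
      using peirce_1_trans[OF d dc p(2)[OF that]] .
    define P L where "P = p(n := q)" and "L = l(n := m)"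
    have PL: "P n = q" "L n = m" "\<And>i. i < n \<Longrightarrow> P i = p i" "\<And>i. i < n \<Longrightarrow> L i = l i"
      by (simp_all add: P_def L_def)
    have "\<forall>i<Suc n. primitive_idempotent (P i) \<and> c \<odot> P i = P i"
      using p(1) cp q PL by (simp add: less_Suc_eq)
    moreover have "\<forall>i<Suc n. \<forall>j<Suc n. i \<noteq> j \<longrightarrow> P i \<odot> P j = 0"
      using p2 orth PL by (auto simp: less_Suc_eq)
    moreover have "(\<Sum>i<Suc n. P i) = c" "(\<Sum>i<Suc n. L i *\<^sub>R P i) = x"
      using p3 PL by simp_all
    ultimately show ?thesis by blast
  qed
qed

text \<open>An idempotent eigenvector of \<open>y\<close> below \<open>p\<close> must equal
  \<open>p\<close> by primitivity, so \<open>y = y \<odot> p\<close> is a multiple of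
  \<open>p\<close>.\<close>

lemma primitive_peirce_1:
  assumes p: "primitive_idempotent p" and y: "p \<odot> y = y"
  shows "\<exists>m. y = m *\<^sub>R p"
proof (cases "y = 0")
  case True
  then show ?thesis by (intro exI[of _ 0]) simp
next
  case False
  have pp: "idempotent p" "p \<odot> p = p" using p by (auto simp: primitive_idempotent_def idempotent_def)
  obtain g l where g: "idempotent g" "g \<noteq> 0" "p \<odot> g = g" "y \<odot> g = l *\<^sub>R g"
    using eigen_idempotent_exists[OF pp(1) y False] by blast
  have "p = g + (p - g)" by simp
  then have "p - g = 0"
    using p g idempotent_diff[OF pp(1) g(1,3)] unfolding primitive_idempotent_def by blast
  then show ?thesis using g y jp_commute[of y] by auto
qed

text \<open>Twice the square of multiplication by \<open>p\<close>, minus that multiplication,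
  projects onto the Peirce 1-space, which here is the line through \<open>p\<close>.\<close>

lemma primitive_quadratic_map:
  assumes "primitive_idempotent p"
  shows "\<exists>a. 2 *\<^sub>R (p \<odot> (p \<odot> y)) = p \<odot> y + a *\<^sub>R p"
proof -
  define w where "w = 2 *\<^sub>R (p \<odot> (p \<odot> y)) - p \<odot> y"
  have "idempotent p" using assms by (simp add: primitive_idempotent_def)
  moreover have "3 *\<^sub>R (p \<odot> (p \<odot> y)) = 2 *\<^sub>R (p \<odot> (p \<odot> y)) + p \<odot> (p \<odot> y)"
    using scaleR_add_left[of 2 1 "p \<odot> (p \<odot> y)"] by simp
  ultimately have "p \<odot> w = w"
    using peirce_polynomial[of p y] by (simp add: w_def jp_simps)
  with primitive_peirce_1[OF assms] obtain a where "w = a *\<^sub>R p" by blast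
  then show ?thesis by (intro exI[of _ a]) (simp add: w_def algebra_simps)
qed

text \<open>Expanding \<open>B (c \<odot> d) (c \<odot> d)\<close> through \<open>c\<close> and through \<open>d\<close> shows that the quadratic maps
  of \<open>c\<close> and \<open>d\<close> send each other to the same multiple.\<close>

lemma primitive_form_eq:
  assumes c: "primitive_idempotent c" and d: "primitive_idempotent d" and cd: "B c d \<noteq> 0"
  shows "B c c = B d d"
proof -
  have half: "B c d * (a + 1) = 2 * B (c \<odot> d) (c \<odot> d) \<and> B c d = a * B c c"
    if a: "2 *\<^sub>R (c \<odot> (c \<odot> d)) = c \<odot> d + a *\<^sub>R c"
      and "c \<odot> c = c" "d \<odot> d = d" for a c d
  proof -
    have 1: "B (c \<odot> d) d = B c d" using that by (simp add: form_assoc)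
    have 2: "B (c \<odot> w) c = B w c" for w using that by (simp add: form_adjoint)
    have "2 * B (c \<odot> d) (c \<odot> d) = B (2 *\<^sub>R (c \<odot> (c \<odot> d))) d"
      by (simp add: form_simps form_adjoint)
    also have "\<dots> = B c d * (a + 1)"
      unfolding a by (simp add: form_simps 1 algebra_simps)
    finally have *: "2 * B (c \<odot> d) (c \<odot> d) = B c d * (a + 1)" .
    have "2 * B d c = B (2 *\<^sub>R (c \<odot> (c \<odot> d))) c"
      by (simp add: form_simps 2)
    also have "\<dots> = B d c + a * B c c"
      unfolding a by (simp add: form_simps 2)
    finally show ?thesis using * form_commute[of c d] by simp
  qed
  have idem: "c \<odot> c = c" "d \<odot> d = d" using c d by (auto simp: primitive_idempotent_def idempotent_def)
  obtain a where a: "2 *\<^sub>R (c \<odot> (c \<odot> d)) = c \<odot> d + a *\<^sub>R c"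
    using primitive_quadratic_map[OF c] by blast
  obtain b where b: "2 *\<^sub>R (d \<odot> (d \<odot> c)) = d \<odot> c + b *\<^sub>R d"
    using primitive_quadratic_map[OF d] by blast
  note h = half[OF a idem] half[OF b idem(2,1)]
  have "B c d * (a + 1) = B c d * (b + 1)"
    using h by (metis form_commute jp_commute)
  then have "a = b" using cd by simp
  moreover have "a * B c c = b * B d d" using h form_commute by metis
  moreover have "a \<noteq> 0" using h cd by auto
  ultimately show ?thesis by simp
qed

section \<open>Construction of the trace functional\<close>

lemma span_primitive_idempotents: "x \<in> span {c. primitive_idempotent c}"
proof -
  have "idempotent e" "e \<odot> x = x" by (simp_all add: idempotent_def jp_unit jp_commute[of e])
  from spectral_decomposition_peirce_1[OF this] obtain n p l where
    "\<forall>i<n. primitive_idempotent (p i)" "(\<Sum>i<(n::nat). l i *\<^sub>R p i) = x" by blast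
  then show ?thesis by (metis (mono_tags, lifting) lessThan_iff mem_Collect_eq span_base span_scale span_sum)
qed

text \<open>The functional is \<open>B f\<close> with \<open>f = (\<Sum>i. c\<^sub>i / B c\<^sub>i c\<^sub>i)\<close> for a complete system of
  orthogonal primitive idempotents \<open>c\<^sub>i\<close>.\<close>

lemma form_trace_functional_exists:
  "\<exists>T. linear T \<and> (\<forall>c. primitive_idempotent c \<longrightarrow> T c = (1::real)) \<and>
     (\<forall>x y z. T ((x \<odot> y) \<odot> z) = T (x \<odot> (y \<odot> z)))"
proof -
  have "idempotent e" "e \<odot> e = e" by (simp_all add: idempotent_def jp_unit)
  from spectral_decomposition_peirce_1[OF this] obtain n p where
    p: "\<And>i. i < n \<Longrightarrow> primitive_idempotent (p i)" "(\<Sum>i<(n::nat). p i) = e" by blast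
  define f where "f = (\<Sum>i<n. inverse (B (p i) (p i)) *\<^sub>R p i)"
  have f_mult: "f \<odot> d = inverse (B d d) *\<^sub>R d" if d: "primitive_idempotent d" for d
  proof -
    \<comment> \<open>Either \<open>p i \<odot> d\<close> vanishes or \<open>p i\<close> and
      \<open>d\<close> have the same length, so one coefficient serves for all
      \<open>i\<close>.\<close>
    have "inverse (B (p i) (p i)) *\<^sub>R (p i \<odot> d) = inverse (B d d) *\<^sub>R (p i \<odot> d)" if "i < n" for i
      using idempotent_orthogonal[of "p i" d] primitive_form_eq[OF p(1)[OF that] d] d p(1)[OF that]
      by (cases "B (p i) d = 0") (auto simp: primitive_idempotent_def)
    then have "(\<Sum>i<n. inverse (B (p i) (p i)) *\<^sub>R (p i \<odot> d)) = (\<Sum>i<n. inverse (B d d) *\<^sub>R (p i \<odot> d))"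
      by (intro sum.cong) auto
    then have "f \<odot> d = inverse (B d d) *\<^sub>R (e \<odot> d)"
      unfolding f_def p(2)[symmetric] by (simp add: jp_sum_left jp_simps scaleR_sum_right)
    then show ?thesis by (simp add: jp_commute[of e] jp_unit)
  qed
  have f_prim: "B f d = 1" if d: "primitive_idempotent d" for d
  proof -
    have "d \<odot> d = d" "d \<noteq> 0" using d by (auto simp: primitive_idempotent_def idempotent_def)
    then have "B f d = B (f \<odot> d) d" by (simp add: form_assoc)
    then show ?thesis using f_mult[OF d] form_eq_0_iff[of d] \<open>d \<noteq> 0\<close> by (simp add: form_simps)
  qed
  \<comment> \<open>Both sides are bilinear, so primitive idempotents suffice. There they are
    multiples of \<open>c \<odot> d\<close>, with equal factors unless this product
    vanishes.\<close>
  have f_central: "x \<odot> (f \<odot> z) = z \<odot> (f \<odot> x)" for x z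
  proof -
    let ?S = "{c. primitive_idempotent c}"
    have bil: "bilinear (\<lambda>x z. x \<odot> (f \<odot> z))" "bilinear (\<lambda>x z. z \<odot> (f \<odot> x))"
      by (auto simp: bilinear_def jp_simps intro!: linearI)
    have "c \<odot> (f \<odot> d) = d \<odot> (f \<odot> c)" if "c \<in> ?S" "d \<in> ?S" for c d
      using that idempotent_orthogonal[of c d] primitive_form_eq[of c d] jp_commute[of d c]
      by (cases "B c d = 0") (auto simp: f_mult jp_simps primitive_idempotent_def)
    from bilinear_eq[OF bil _ _ UNIV_I UNIV_I this] show ?thesis
      using span_primitive_idempotents by blast
  qed
  have "B f ((x \<odot> y) \<odot> z) = B f (x \<odot> (y \<odot> z))" for x y z
  proof -
    have "B f ((x \<odot> y) \<odot> z) = B y (x \<odot> (f \<odot> z))"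
      using form_commute[of f "(x \<odot> y) \<odot> z"] jp_commute[of z f] jp_commute[of "x \<odot> y" z]
      by (simp add: form_adjoint)
    also have "\<dots> = B y (z \<odot> (f \<odot> x))"
      by (simp add: f_central)
    also have "\<dots> = B f (x \<odot> (y \<odot> z))"
      using form_commute[of f "x \<odot> (y \<odot> z)"] jp_commute[of x f] jp_commute[of y z]
      by (simp add: form_adjoint)
    finally show ?thesis .
  qed
  then show ?thesis using linear_form[of f] f_prim by blast
qed

end

subsection \<open>Rank and trace\<close>

context euclidean_jordan_algebra
begin

lemma trace_functional_exists:
  "\<exists>T. linear T \<and> (\<forall>c. primitive_idempotent c \<longrightarrow> T c = (1::real)) \<and>
     (\<forall>x y z. T ((x \<odot> y) \<odot> z) = T (x \<odot> (y \<odot> z)))"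
proof -
  obtain B where B: "bilinear B" "\<And>x y z. B (x \<odot> y) z = (B x (y \<odot> z) :: real)"
    "\<And>x. x \<noteq> 0 \<Longrightarrow> 0 < B x x" using ex_associative_form by blast
  interpret form: associative_form "(\<odot>)" e B
    using B by unfold_locales auto
  show ?thesis by (rule form.form_trace_functional_exists)
qed

text \<open>A Jordan frame of unspecified length, usable before \<open>jrank_eq\<close> identifies
  the length with the rank.\<close>

definition complete_frame :: "nat \<Rightarrow> (nat \<Rightarrow> 'a) \<Rightarrow> bool" where
  "complete_frame n c \<longleftrightarrow> (\<forall>i<n. primitive_idempotent (c i)) \<and>
     (\<forall>i<n. \<forall>j<n. i \<noteq> j \<longrightarrow> c i \<odot> c j = 0) \<and> (\<Sum>i<n. c i) = e"

lemma complete_frame_exists: "\<exists>n c l. complete_frame n c \<and> x = (\<Sum>i<n. l i *\<^sub>R c i)"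
proof -
  obtain B where B: "bilinear B" "\<And>x y z. B (x \<odot> y) z = (B x (y \<odot> z) :: real)"
    "\<And>x. x \<noteq> 0 \<Longrightarrow> 0 < B x x" using ex_associative_form by blast
  interpret form: associative_form "(\<odot>)" e B
    using B by unfold_locales auto
  have "idempotent e" "e \<odot> x = x" by (simp_all add: idempotent_def jp_unit jp_commute[of e])
  from form.spectral_decomposition_peirce_1[OF this] show ?thesis
    unfolding complete_frame_def by metis
qed

lemma complete_frame_mult:
  assumes "complete_frame n c"
  shows "(\<Sum>i<n. a i *\<^sub>R c i) \<odot> (\<Sum>i<n. b i *\<^sub>R c i) = (\<Sum>i<n. (a i * b i) *\<^sub>R c i)"
proof -
  have "(a i *\<^sub>R c i) \<odot> (\<Sum>j<n. b j *\<^sub>R c j) = (a i * b i) *\<^sub>R c i" if "i < n" for i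
  proof -
    have "(\<Sum>j<n. (a i *\<^sub>R c i) \<odot> (b j *\<^sub>R c j)) = (\<Sum>j<n. if i = j then (a i * b j) *\<^sub>R c j else 0)"
      using assms that
      by (intro sum.cong) (auto simp: complete_frame_def primitive_idempotent_def idempotent_def jp_simps)
    then show ?thesis using that by (simp add: jp_sum_right)
  qed
  then show ?thesis by (simp add: jp_sum_left)
qed

lemma complete_frame_jpow:
  assumes "complete_frame n c"
  shows "jpow (\<Sum>i<n. l i *\<^sub>R c i) k = (\<Sum>i<n. l i ^ k *\<^sub>R c i)"
proof (induction k)
  case 0
  then show ?case using assms by (simp add: complete_frame_def)
next
  case (Suc k)
  then show ?case using complete_frame_mult[OF assms] by simp
qed

lemma complete_frame_independent:
  assumes "complete_frame n c" "(\<Sum>i<n. a i *\<^sub>R c i) = 0" "j < n"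
  shows "a j = 0"
proof -
  \<comment> \<open>Multiplying the relation by \<open>c j\<close>, written with indicator
    coefficients, isolates the coefficient \<open>a j\<close>.\<close>
  have "(\<Sum>i<n. (if i = j then 1 else 0) *\<^sub>R c i) = c j"
    using assms(3) by (simp add: if_distrib[of "\<lambda>t. t *\<^sub>R _"] cong: if_cong)
  then have "(\<Sum>i<n. (a i * (if i = j then 1 else 0)) *\<^sub>R c i) = 0"
    using complete_frame_mult[OF assms(1), of a "\<lambda>i. if i = j then 1 else 0"] assms(2)
    by (simp add: jp_simps)
  then have "a j *\<^sub>R c j = 0"
    using assms(3) by (simp add: if_distrib[of "\<lambda>t. (_ * t) *\<^sub>R _"] cong: if_cong)
  then show ?thesis using assms(1,3) by (auto simp: complete_frame_def primitive_idempotent_def)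
qed

lemma complete_frame_powers:
  assumes "complete_frame n c"
  shows "(\<Sum>k\<le>m. a k *\<^sub>R jpow (\<Sum>i<n. l i *\<^sub>R c i) k) = (\<Sum>i<n. (\<Sum>k\<le>m. a k * l i ^ k) *\<^sub>R c i)"
  unfolding complete_frame_jpow[OF assms]
  by (simp add: scaleR_sum_right scaleR_sum_left) (rule sum.swap)

text \<open>The trace functional takes the value \<open>n\<close> at \<open>e\<close>, so \<open>n\<close> is independent of the frame.\<close>

lemma jrank_eq:
  assumes c: "complete_frame n c"
  shows "jrank = n"
  unfolding jrank_def
proof (rule Least_equality)
  obtain T where T: "linear T" "\<And>d. primitive_idempotent d \<Longrightarrow> T d = (1::real)"
    using trace_functional_exists by blast
  have size: "real k = T e" if "complete_frame k d" for k d
    using that linear_sum[OF T(1), of d "{..<k}"] T(2) by (simp add: complete_frame_def)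
  show "\<forall>x. powers_dependent x n"
  proof
    fix x
    obtain k d l where d: "complete_frame k d" "x = (\<Sum>i<k. l i *\<^sub>R d i)"
      using complete_frame_exists by blast
    have k: "k = n" using size[OF c] size[OF d(1)] by simp
    \<comment> \<open>All eigenvalues of \<open>x\<close> are roots, so \<open>p\<close> annihilates
      \<open>x\<close>; the nonzero leading coefficient makes the dependence nontrivial.\<close>
    define p where "p = (\<Prod>i<n. [:- l i, 1:])"
    have deg: "degree p = n" "p \<noteq> 0" by (simp_all add: p_def degree_prod_sum_eq prod_zero_iff)
    have "(\<Sum>j\<le>n. coeff p j * l i ^ j) = 0" if "i < n" for i
    proof -
      have "poly p (l i) = 0" using that by (auto simp: p_def poly_prod)
      then show ?thesis using poly_altdef[of p "l i"] deg(1) by simp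
    qed
    then have "(\<Sum>j\<le>n. coeff p j *\<^sub>R jpow x j) = 0"
      unfolding d(2) k complete_frame_powers[OF d(1)[unfolded k]] by simp
    moreover have "coeff p n \<noteq> 0" using deg by (metis leading_coeff_0_iff)
    ultimately show "powers_dependent x n" unfolding powers_dependent_def by blast
  qed
  \<comment> \<open>The test element has \<open>n\<close> distinct eigenvalues
    \<open>0, ..., n - 1\<close>, each a root of a nonzero polynomial of degree at most
    \<open>m\<close>.\<close>
  fix m assume "\<forall>x. powers_dependent x m"
  then obtain a :: "nat \<Rightarrow> real" where a: "\<exists>k\<le>m. a k \<noteq> 0"
    "(\<Sum>j\<le>m. a j *\<^sub>R jpow (\<Sum>i<n. real i *\<^sub>R c i) j) = 0"
    unfolding powers_dependent_def by blast
  then have "(\<Sum>j\<le>m. a j * real i ^ j) = 0" if "i < n" for i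
    using complete_frame_independent[OF c _ that] complete_frame_powers[OF c] by simp
  then have "real ` {..<n} \<subseteq> {z. (\<Sum>j\<le>m. a j * z ^ j) = 0}" by auto
  then have "card (real ` {..<n}) \<le> card {z. (\<Sum>j\<le>m. a j * z ^ j) = 0}"
    by (intro card_mono polyfun_rootbound_finite[OF a(1)])
  also have "\<dots> \<le> m" by (rule polyfun_rootbound_card[OF a(1)])
  finally show "n \<le> m" by (simp add: card_image)
qed

lemma jordan_frame_iff: "jordan_frame c \<longleftrightarrow> complete_frame jrank c"
  by (simp add: jordan_frame_def complete_frame_def)

lemma eigenvalues_decomposition:
  "\<exists>c. complete_frame jrank c \<and> x = (\<Sum>i<jrank. eigenvalues x i *\<^sub>R c i)"
proof -
  obtain n c l where c: "complete_frame n c" "x = (\<Sum>i<n. l i *\<^sub>R c i)"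
    using complete_frame_exists by blast
  then have "\<exists>l c. spectral_decomposition x l c"
    using jrank_eq[OF c(1)] by (auto simp: spectral_decomposition_def jordan_frame_iff)
  then have "\<exists>c. spectral_decomposition x (eigenvalues x) c"
    unfolding eigenvalues_def by (rule someI_ex)
  then show ?thesis by (simp add: spectral_decomposition_def jordan_frame_iff)
qed

lemma jrank_pos: "0 < jrank"
proof (rule gr0I)
  assume "jrank = 0"
  then show False
    using eigenvalues_decomposition[of e] unit_nonzero by simp
qed

text \<open>Such a functional sums the coefficients in every frame, so the choice made in
  \<open>eigenvalues\<close> has no influence on the trace.\<close>

lemma jtrace_eq:
  assumes "linear T" "\<And>c. primitive_idempotent c \<Longrightarrow> T c = (1::real)"
  shows "jtrace = T"
proof
  fix x
  obtain c where c: "complete_frame jrank c" "x = (\<Sum>i<jrank. eigenvalues x i *\<^sub>R c i)"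
    using eigenvalues_decomposition by blast
  have "T x = (\<Sum>i<jrank. eigenvalues x i * T (c i))"
    by (subst c(2)) (simp add: linear_sum[OF assms(1)] linear_scale[OF assms(1)])
  then show "jtrace x = T x"
    using c(1) assms(2) by (simp add: jtrace_def complete_frame_def)
qed

lemma linear_jtrace: "linear jtrace"
  and jtrace_primitive: "primitive_idempotent c \<Longrightarrow> jtrace c = 1"
  and jtrace_assoc: "jtrace ((x \<odot> y) \<odot> z) = jtrace (x \<odot> (y \<odot> z))"
  using trace_functional_exists jtrace_eq by metis+

lemma jtrace_frame:
  assumes "complete_frame n c"
  shows "jtrace (\<Sum>i<n. l i *\<^sub>R c i) = (\<Sum>i<n. l i)"
  using assms
  by (simp add: linear_sum[OF linear_jtrace] linear_scale[OF linear_jtrace] jtrace_primitive complete_frame_def)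

end

text \<open>Everything proved for an arbitrary form \<open>B\<close> becomes available for the trace
  inner product.\<close>

sublocale euclidean_jordan_algebra \<subseteq> trace: associative_form jp e jinner
proof
  show "bilinear jinner"
    unfolding bilinear_def jinner_def
    by (auto intro!: linearI simp: jp_simps linear_add[OF linear_jtrace] linear_scale[OF linear_jtrace])
  show "jinner (jp x y) z = jinner x (jp y z)" for x y z
    by (simp add: jinner_def jtrace_assoc)
  fix x :: 'a assume "x \<noteq> 0"
  obtain c where c: "complete_frame jrank c" "x = (\<Sum>i<jrank. eigenvalues x i *\<^sub>R c i)"
    using eigenvalues_decomposition by blast
  obtain k where k: "k < jrank" "eigenvalues x k \<noteq> 0"
    using \<open>x \<noteq> 0\<close> c(2) by (metis (no_types, lifting) lessThan_iff scaleR_zero_left sum.neutral)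
  have "jinner x x = (\<Sum>i<jrank. eigenvalues x i * eigenvalues x i)"
    unfolding jinner_def by (subst (1 2) c(2)) (simp add: complete_frame_mult[OF c(1)] jtrace_frame[OF c(1)])
  also have "\<dots> > 0"
    using k by (intro sum_pos2[of _ k]) (auto simp: zero_less_mult_iff)
  finally show "0 < jinner x x" .
qed

subsection \<open>The cone of squares\<close>

context euclidean_jordan_algebra
begin

lemma jinner_primitive:
  assumes "primitive_idempotent c"
  shows "jinner c c = 1" "jinner e c = 1"
  using assms jtrace_primitive[OF assms]
  by (simp_all add: jinner_def primitive_idempotent_def idempotent_def jp_commute[of e] jp_unit)

lemma jinner_frame:
  assumes "complete_frame n c"
  shows "jinner (\<Sum>i<n. a i *\<^sub>R c i) (\<Sum>i<n. b i *\<^sub>R c i) = (\<Sum>i<n. a i * b i)"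
  by (simp add: jinner_def complete_frame_mult[OF assms] jtrace_frame[OF assms])

lemma jinner_frame_element:
  assumes "complete_frame n c" "j < n"
  shows "jinner (c j) (\<Sum>i<n. l i *\<^sub>R c i) = l j"
proof -
  have "c j = (\<Sum>i<n. (if i = j then 1 else 0) *\<^sub>R c i)"
    using assms(2) by (simp add: if_distrib[of "\<lambda>t. t *\<^sub>R _"] cong: if_cong)
  then have "jinner (c j) (\<Sum>i<n. l i *\<^sub>R c i) = (\<Sum>i<n. (if i = j then 1 else 0) * l i)"
    using jinner_frame[OF assms(1)] by simp
  then show ?thesis
    using assms(2) by (simp add: if_distrib[of "\<lambda>t. t * _"] cong: if_cong)
qed

lemma frob_norm_square: "(frob_norm x)\<^sup>2 = jinner x x"
  by (simp add: frob_norm_def trace.form_nonneg)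

text \<open>This turns out to be the cone of squares; as an intersection of half-spaces it is
  visibly closed and convex.\<close>

definition dual_cone :: "'a set" where
  "dual_cone = {x. \<forall>c. primitive_idempotent c \<longrightarrow> 0 \<le> jinner x c}"

lemma dual_cone_frame_nonneg:
  assumes "complete_frame n c" "(\<Sum>i<n. l i *\<^sub>R c i) \<in> dual_cone" "i < n"
  shows "0 \<le> l i"
  using assms jinner_frame_element[OF assms(1,3), of l]
    trace.form_commute[of "\<Sum>i<n. l i *\<^sub>R c i"]
  by (auto simp: dual_cone_def complete_frame_def)

text \<open>Squares pair nonnegatively with idempotents. Conversely, frame elements detect the
  eigenvalues, and a square root is taken within the frame.\<close>

lemma squares_eq_dual_cone: "{x \<odot> x | x. True} = dual_cone"
proof (intro equalityI subsetI)
  fix y assume "y \<in> {x \<odot> x | x. True}"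
  then show "y \<in> dual_cone"
    using trace.idempotent_form_square by (auto simp: dual_cone_def primitive_idempotent_def)
next
  fix y assume y: "y \<in> dual_cone"
  obtain c where c: "complete_frame jrank c" "y = (\<Sum>i<jrank. eigenvalues y i *\<^sub>R c i)"
    using eigenvalues_decomposition by blast
  have "0 \<le> eigenvalues y i" if "i < jrank" for i
    using dual_cone_frame_nonneg[OF c(1) _ that] c(2) y by metis
  then have "y = (\<Sum>i<jrank. sqrt (eigenvalues y i) *\<^sub>R c i) \<odot> (\<Sum>i<jrank. sqrt (eigenvalues y i) *\<^sub>R c i)"
    by (subst c(2)) (simp add: complete_frame_mult[OF c(1)])
  then show "y \<in> {x \<odot> x | x. True}" by blast
qed

lemma closed_dual_cone: "closed dual_cone"
  unfolding dual_cone_def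
  by (intro closed_Collect_all closed_Collect_imp closed_Collect_le open_Collect_const)
     (intro continuous_intros)+

text \<open>A trace-norm ball whose radius is the least coefficient \<open>m\<close> stays in the
  cone: the center pairs with a primitive \<open>d\<close> to at least \<open>m\<close>, since
  \<open>jinner e d = 1\<close>, and by Cauchy-Schwarz the displacement changes this by less than
  \<open>m\<close>.\<close>

lemma frame_positive_in_Omega:
  assumes c: "complete_frame n c" and l: "\<And>i. i < n \<Longrightarrow> 0 < l i"
  shows "(\<Sum>i<n. l i *\<^sub>R c i) \<in> Omega"
proof -
  define x where "x = (\<Sum>i<n. l i *\<^sub>R c i)"
  define m where "m = Min (l ` {..<n})"
  have n: "n > 0" using jrank_eq[OF c] jrank_pos by simp
  have m: "0 < m" using n l by (subst m_def, subst Min_gr_iff) auto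
  have ml: "m \<le> l i" if "i < n" for i using that by (simp add: m_def)
  define S where "S = {y. jinner (y - x) (y - x) < m\<^sup>2}"
  have "open S"
    unfolding S_def by (intro open_Collect_less) (intro continuous_intros)+
  moreover have "x \<in> S" using m by (simp add: S_def trace.form_simps)
  moreover have "S \<subseteq> dual_cone"
  proof
    fix y assume y: "y \<in> S"
    have "0 \<le> jinner y d" if d: "primitive_idempotent d" for d
    proof -
      have nonneg: "0 \<le> jinner (c i) d" if "i < n" for i
      proof -
        have "c i \<odot> c i = c i" "idempotent d"
          using c d that by (auto simp: complete_frame_def primitive_idempotent_def idempotent_def)
        then show ?thesis using trace.idempotent_form_square[of d "c i"] by simp
      qed
      have "m = m * jinner e d" using jinner_primitive[OF d] by simp
      also have "\<dots> = (\<Sum>i<n. m * jinner (c i) d)"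
        using c by (simp add: complete_frame_def trace.form_sum_left[symmetric] sum_distrib_left[symmetric])
      also have "\<dots> \<le> (\<Sum>i<n. l i * jinner (c i) d)"
        using ml nonneg by (intro sum_mono mult_right_mono) auto
      also have "\<dots> = jinner x d" by (simp add: x_def trace.form_sum_left trace.form_simps)
      finally have "m \<le> jinner x d" .
      moreover have "(jinner (y - x) d)\<^sup>2 < m\<^sup>2"
        using trace.form_Cauchy_Schwarz_unit[OF jinner_primitive(1)[OF d], of "y - x"] y
        by (simp add: S_def)
      then have "\<bar>jinner (y - x) d\<bar> < m"
        using m power2_less_imp_less[of "\<bar>jinner (y - x) d\<bar>" m] by simp
      ultimately show ?thesis by (simp add: trace.form_simps)
    qed
    then show "y \<in> dual_cone" by (simp add: dual_cone_def)
  qed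
  ultimately show ?thesis
    unfolding Omega_def squares_eq_dual_cone x_def[symmetric] by (rule interiorI)
qed

lemma closure_Omega: "closure Omega = dual_cone"
proof (intro equalityI subsetI)
  have "Omega \<subseteq> dual_cone"
    unfolding Omega_def squares_eq_dual_cone by (rule interior_subset)
  then show "x \<in> dual_cone" if "x \<in> closure Omega" for x
    using closure_minimal[OF _ closed_dual_cone] that by blast
next
  fix x assume x: "x \<in> dual_cone"
  obtain c where c: "complete_frame jrank c" "x = (\<Sum>i<jrank. eigenvalues x i *\<^sub>R c i)"
    using eigenvalues_decomposition by blast
  have nonneg: "0 \<le> eigenvalues x i" if "i < jrank" for i
    using dual_cone_frame_nonneg[OF c(1) _ that] c(2) x by metis
  have "\<exists>y\<in>Omega. dist y x < d" if "d > 0" for d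
  proof -
    \<comment> \<open>Adding \<open>t *\<^sub>R e\<close> raises every eigenvalue by
      \<open>t\<close> and moves \<open>x\<close> by exactly \<open>d / 2\<close>.\<close>
    define t where "t = d / (2 * norm e)"
    have t: "t > 0" using that unit_nonzero by (simp add: t_def)
    have "(\<Sum>i<jrank. (eigenvalues x i + t) *\<^sub>R c i) = x + t *\<^sub>R e"
      using c by (simp add: scaleR_add_left sum.distrib scaleR_sum_right[symmetric] complete_frame_def)
    moreover have "(\<Sum>i<jrank. (eigenvalues x i + t) *\<^sub>R c i) \<in> Omega"
      using nonneg t by (intro frame_positive_in_Omega[OF c(1)]) (simp add: add_nonneg_pos)
    moreover have "dist (x + t *\<^sub>R e) x < d"
      using that t unit_nonzero by (simp add: dist_norm t_def)
    ultimately show ?thesis by metis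
  qed
  then show "x \<in> closure Omega" by (simp add: closure_approachable)
qed

text \<open>Moreau decomposition: \<open>p\<close> lies in the cone, \<open>m\<close> is orthogonal
  to \<open>p\<close> and pairs nonpositively with the cone, so \<open>p\<close> is the unique
  nearest point and Pythagoras applies.\<close>

lemma frob_norm_pos_part: "frob_norm (pos_part v) \<le> frob_norm v"
proof -
  obtain c where c: "complete_frame jrank c" "v = (\<Sum>i<jrank. eigenvalues v i *\<^sub>R c i)"
    using eigenvalues_decomposition by blast
  define p where "p = (\<Sum>i<jrank. max (eigenvalues v i) 0 *\<^sub>R c i)"
  define m where "m = (\<Sum>i<jrank. min (eigenvalues v i) 0 *\<^sub>R c i)"
  have v: "v = p + m"
    unfolding p_def m_def sum.distrib[symmetric] scaleR_add_left[symmetric]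
    by (subst c(2)) (intro sum.cong, auto simp: max_def min_def)
  have mp: "jinner m p = 0"
    unfolding p_def m_def jinner_frame[OF c(1)] by (intro sum.neutral) (auto simp: max_def min_def)
  have nonneg: "0 \<le> jinner (c i) d" if "i < jrank" "d \<in> dual_cone" for i d
    using c(1) that trace.form_commute[of "c i"] by (auto simp: dual_cone_def complete_frame_def)
  have mw: "jinner m w \<le> 0" if "w \<in> dual_cone" for w
    unfolding m_def trace.form_sum_left
    using nonneg[OF _ that] by (intro sum_nonpos) (auto simp: trace.form_simps mult_nonpos_nonneg)
  have "p = (\<Sum>i<jrank. sqrt (max (eigenvalues v i) 0) *\<^sub>R c i) \<odot> (\<Sum>i<jrank. sqrt (max (eigenvalues v i) 0) *\<^sub>R c i)"
    by (simp add: complete_frame_mult[OF c(1)] p_def)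
  then have p: "p \<in> dual_cone" unfolding squares_eq_dual_cone[symmetric] by blast
  have dist: "jinner (v - w) (v - w) \<ge> jinner m m + jinner (p - w) (p - w)" if "w \<in> dual_cone" for w
    using mw[OF that] mp trace.form_commute[of p m] trace.form_commute[of w m]
    by (simp add: v trace.form_simps algebra_simps)
  let ?f = "\<lambda>w. frob_norm (v - w)"
  have "is_arg_min ?f (\<lambda>w. w \<in> dual_cone) p"
    unfolding is_arg_min_linorder
  proof (intro conjI allI impI)
    fix w assume "w \<in> dual_cone"
    from dist[OF this] show "?f p \<le> ?f w"
      using trace.form_nonneg[of "p - w"] by (simp add: frob_norm_def v)
  qed (rule p)
  then have "is_arg_min ?f (\<lambda>w. w \<in> dual_cone) (pos_part v)"
    unfolding pos_part_def arg_min_on_def arg_min_def closure_Omega by (rule someI)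
  then have w: "pos_part v \<in> dual_cone" "?f (pos_part v) \<le> ?f p"
    using p by (auto simp: is_arg_min_linorder)
  \<comment> \<open>The quadratic growth in \<open>dist\<close> pins the chosen minimizer to
    \<open>p\<close>.\<close>
  have "jinner (p - pos_part v) (p - pos_part v) \<le> 0"
    using dist[OF w(1)] w(2) by (simp add: frob_norm_def v)
  then have "pos_part v = p"
    using trace.form_nonneg[of "p - pos_part v"] trace.form_eq_0_iff[of "p - pos_part v"] by simp
  moreover have "jinner p p \<le> jinner v v"
    using mp trace.form_commute[of p m] trace.form_nonneg[of m] by (simp add: v trace.form_simps)
  ultimately show ?thesis by (simp add: frob_norm_def)
qed

section \<open>The spectraplex\<close>

lemma mem_spectraplex: "x \<in> spectraplex \<longleftrightarrow> x \<in> dual_cone \<and> jtrace x = 1"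
  by (simp add: spectraplex_def closure_Omega jinner_def jp_commute[of e] jp_unit)

lemma spectraplex_frame:
  assumes "x \<in> spectraplex"
  shows "i < jrank \<Longrightarrow> 0 \<le> eigenvalues x i" and "(\<Sum>i<jrank. eigenvalues x i) = 1"
proof -
  obtain c where c: "complete_frame jrank c" "x = (\<Sum>i<jrank. eigenvalues x i *\<^sub>R c i)"
    using eigenvalues_decomposition by blast
  show "0 \<le> eigenvalues x i" if "i < jrank"
    using dual_cone_frame_nonneg[OF c(1) _ that] c(2) assms mem_spectraplex by metis
  show "(\<Sum>i<jrank. eigenvalues x i) = 1"
    using assms by (simp add: mem_spectraplex jtrace_def)
qed

text \<open>The eigenvalues lie in [0,1] and sum to 1, so their squares sum to at most 1.\<close>

lemma spectraplex_jinner_le_1: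
  assumes "x \<in> spectraplex"
  shows "jinner x x \<le> 1"
proof -
  obtain c where c: "complete_frame jrank c" "x = (\<Sum>i<jrank. eigenvalues x i *\<^sub>R c i)"
    using eigenvalues_decomposition by blast
  note nonneg = spectraplex_frame(1)[OF assms]
  have le1: "eigenvalues x i \<le> 1" if "i < jrank" for i
    using member_le_sum[of i "{..<jrank}" "eigenvalues x"] that nonneg spectraplex_frame(2)[OF assms] by simp
  have "jinner x x = (\<Sum>i<jrank. eigenvalues x i * eigenvalues x i)"
    using jinner_frame[OF c(1), of "eigenvalues x" "eigenvalues x"] c(2) by metis
  also have "\<dots> \<le> (\<Sum>i<jrank. eigenvalues x i)"
    using nonneg le1 by (intro sum_mono) (simp add: mult_left_le)
  finally show ?thesis using spectraplex_frame(2)[OF assms] by simp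
qed

lemma spectraplex_spec_norm:
  assumes "x \<in> spectraplex"
  shows "1 / real jrank \<le> spec_norm x"
proof -
  have "1 = (\<Sum>i<jrank. eigenvalues x i)" using spectraplex_frame(2)[OF assms] by simp
  also have "\<dots> \<le> (\<Sum>i<jrank. spec_norm x)"
    unfolding spec_norm_def
    by (intro sum_mono order_trans[OF abs_ge_self Max_ge]) auto
  finally show ?thesis using jrank_pos by (simp add: field_simps)
qed

lemma spectraplex_convex:
  assumes "x \<in> spectraplex" "y \<in> spectraplex" "0 \<le> t" "t \<le> 1"
  shows "x + t *\<^sub>R (y - x) \<in> spectraplex"
proof -
  have eq: "x + t *\<^sub>R (y - x) = (1 - t) *\<^sub>R x + t *\<^sub>R y" by (simp add: algebra_simps)
  show ?thesis
    unfolding eq using assms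
    by (auto simp: mem_spectraplex dual_cone_def trace.form_simps
        linear_add[OF linear_jtrace] linear_scale[OF linear_jtrace])
qed

lemma primitive_in_spectraplex:
  assumes "primitive_idempotent c"
  shows "c \<in> spectraplex"
proof -
  have "c = c \<odot> c" using assms by (simp add: primitive_idempotent_def idempotent_def)
  then have "c \<in> dual_cone" unfolding squares_eq_dual_cone[symmetric] by blast
  then show ?thesis using jtrace_primitive[OF assms] by (simp add: mem_spectraplex)
qed

lemma spectraplex_minimizer_nonpos:
  assumes u: "spectraplex_minimizer u" and v: "v \<notin> Omega"
  shows "u v \<in> spectraplex" "jinner (u v) v \<le> 0"
proof -
  have u': "u v \<in> spectraplex" "\<And>w. w \<in> spectraplex \<Longrightarrow> jinner (u v) v \<le> jinner w v"
    using u by (auto simp: spectraplex_minimizer_def is_arg_min_linorder)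
  obtain c where c: "complete_frame jrank c" "v = (\<Sum>i<jrank. eigenvalues v i *\<^sub>R c i)"
    using eigenvalues_decomposition by blast
  \<comment> \<open>With only positive eigenvalues \<open>v\<close> would lie in
    \<open>Omega\<close>; the frame element of a nonpositive one is the competitor.\<close>
  obtain i where i: "i < jrank" "eigenvalues v i \<le> 0"
    using frame_positive_in_Omega[OF c(1), of "eigenvalues v"] c(2) v by (metis not_le)
  have "jinner (c i) v = eigenvalues v i"
    using jinner_frame_element[OF c(1) i(1)] c(2) by metis
  moreover have "c i \<in> spectraplex"
    using c(1) i(1) by (intro primitive_in_spectraplex) (simp add: complete_frame_def)
  ultimately show "jinner (u v) v \<le> 0" using u'(2)[of "c i"] i(2) by simp
  show "u v \<in> spectraplex" by (rule u'(1))
qed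

subsection \<open>The von Neumann scheme\<close>

text \<open>\<open>P\<close> is specified pointwise by orthogonality; this uniqueness yields its
  affinity along segments.\<close>

lemma orthogonal_projection_unique:
  assumes P: "orthogonal_projection_onto L P" and y: "y \<in> L" "\<And>w. w \<in> L \<Longrightarrow> jinner (x - y) w = 0"
  shows "P x = y"
proof -
  have L: "subspace L" "P x \<in> L" "\<And>w. w \<in> L \<Longrightarrow> jinner (x - P x) w = 0"
    using P by (auto simp: orthogonal_projection_onto_def)
  define d where "d = y - P x"
  have "d \<in> L" using L y by (simp add: d_def subspace_diff)
  then have "jinner (x - P x) d - jinner (x - y) d = 0" using L(3) y(2) by simp
  then have "jinner d d = 0" by (simp add: d_def trace.form_simps)
  then show ?thesis by (simp add: trace.form_eq_0_iff d_def)
qed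

lemma orthogonal_projection:
  assumes P: "orthogonal_projection_onto L P"
  shows "P (x + t *\<^sub>R (y - x)) = P x + t *\<^sub>R (P y - P x)"
    and "jinner (P x) (P y) = jinner x (P y)"
    and "jinner (P x) (P x) \<le> jinner x x"
proof -
  have L: "subspace L" "\<And>x. P x \<in> L" "\<And>x w. w \<in> L \<Longrightarrow> jinner (x - P x) w = 0"
    using P by (auto simp: orthogonal_projection_onto_def)
  have orth: "jinner x w = jinner (P x) w" if "w \<in> L" for x w
    using L(3)[OF that, of x] by (simp add: trace.form_simps)
  show "P (x + t *\<^sub>R (y - x)) = P x + t *\<^sub>R (P y - P x)"
  proof (rule orthogonal_projection_unique[OF P])
    show "P x + t *\<^sub>R (P y - P x) \<in> L"
      using L by (simp add: subspace_add subspace_scale subspace_diff)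
  next
    fix w assume "w \<in> L"
    then show "jinner (x + t *\<^sub>R (y - x) - (P x + t *\<^sub>R (P y - P x))) w = 0"
      using orth[of w x] orth[of w y] by (simp add: trace.form_simps)
  qed
  show "jinner (P x) (P y) = jinner x (P y)" using orth[OF L(2)] by simp
  have "0 \<le> jinner (x - P x) (x - P x)" by (rule trace.form_nonneg)
  then show "jinner (P x) (P x) \<le> jinner x x"
    using orth[OF L(2), of x x] trace.form_commute[of "P x" x] by (simp add: trace.form_simps)
qed

lemma step_size_bound:
  assumes P: "orthogonal_projection_onto L P"
    and w: "w \<in> spectraplex" "jinner w (P z) \<le> 0" and a: "0 < jinner (P z) (P z)"
  defines "s \<equiv> step_size P z w" and "a \<equiv> jinner (P z) (P z)"
  shows "0 \<le> s" "s \<le> 1" "jinner (P (z + s *\<^sub>R (w - z))) (P (z + s *\<^sub>R (w - z))) \<le> a / (1 + a)"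
proof -
  define b c where "b = jinner (P w) (P w)" and "c = jinner (P w) (P z)"
  define f where "f = (\<lambda>t. (frob_norm (P (z + t *\<^sub>R (w - z))))\<^sup>2)"
  have f: "f t = (1 - t)\<^sup>2 * a + t\<^sup>2 * b + 2 * t * (1 - t) * c" for t
    unfolding f_def frob_norm_square orthogonal_projection(1)[OF P] a_def b_def c_def
    using trace.form_commute[of "P z" "P w"]
    by (simp add: trace.form_simps power2_eq_square algebra_simps)
  have b: "0 \<le> b" "b \<le> 1"
    using orthogonal_projection(3)[OF P, of w] spectraplex_jinner_le_1[OF w(1)] trace.form_nonneg[of "P w"]
    by (auto simp: b_def)
  have c: "c \<le> 0" using orthogonal_projection(2)[OF P, of w z] w(2) by (simp add: c_def)
  have a_pos: "0 < a" using a by (simp add: a_def)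
  \<comment> \<open>A minimizer exists by compactness, so the choice in \<open>arg_min_on\<close>
    really returns one.\<close>
  have "continuous_on {0..1} f"
    unfolding f by (intro continuous_intros)
  then obtain t where "t \<in> {0..1}" "\<And>y. y \<in> {0..1} \<Longrightarrow> f t \<le> f y"
    using continuous_attains_inf[of "{0..1::real}" f] by auto
  then have "is_arg_min f (\<lambda>t. t \<in> {0..1}) t" by (simp add: is_arg_min_linorder)
  then have "is_arg_min f (\<lambda>t. t \<in> {0..1}) s"
    unfolding s_def step_size_def arg_min_on_def arg_min_def f_def by (rule someI)
  then have s: "s \<in> {0..1}" "\<And>y. y \<in> {0..1} \<Longrightarrow> f s \<le> f y"
    by (auto simp: is_arg_min_linorder)
  then show "0 \<le> s" "s \<le> 1" by auto
  \<comment> \<open>Minimizer of \<open>(1 - t)^2 * a + t^2\<close>, the bound on \<open>f t\<close>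
    that follows from \<open>b \<le> 1\<close> and \<open>c \<le> 0\<close>.\<close>
  let ?t = "a / (1 + a)"
  have t: "0 \<le> ?t" "?t \<le> 1" "1 - ?t = 1 / (1 + a)" using a_pos by (auto simp: field_simps)
  have "f s \<le> f ?t" using t by (intro s(2)) auto
  also have "\<dots> \<le> (1 - ?t)\<^sup>2 * a + ?t\<^sup>2 * 1 + 0"
    unfolding f
  proof (intro add_mono mult_left_mono)
    show "2 * ?t * (1 - ?t) * c \<le> 0"
      using t(1,2) c by (intro mult_nonneg_nonpos mult_nonneg_nonneg) simp_all
  qed (use b in auto)
  also have "\<dots> = a / (1 + a)"
    unfolding t(3) using a_pos by (simp add: power2_eq_square divide_simps) (simp add: algebra_simps)
  finally show "jinner (P (z + s *\<^sub>R (w - z))) (P (z + s *\<^sub>R (w - z))) \<le> a / (1 + a)"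
    by (simp add: f_def frob_norm_square)
qed

text \<open>The invariant is \<open>\<parallel>P z\<^sub>t\<parallel>\<^sup>2 \<le> 1 / (t + 1)\<close>: a step maps \<open>a = \<parallel>P z\<^sub>t\<parallel>\<^sup>2\<close> to at most
  \<open>a / (1 + a)\<close>, that is, it increases \<open>1 / a\<close> by at least 1.\<close>

lemma von_neumann_scheme_terminates:
  fixes N :: nat
  assumes P: "orthogonal_projection_onto L P" and u: "spectraplex_minimizer u"
    and z0: "z0 \<in> spectraplex"
    and stop: "\<And>z. z \<in> spectraplex \<Longrightarrow> \<not> stop z \<Longrightarrow> P z \<notin> Omega \<and> 1 < N * jinner (P z) (P z)"
  shows "\<exists>z t. von_neumann_scheme P u stop z0 = Some (z, t) \<and> stop z \<and> t \<le> N"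
proof -
  define b where "b = (\<lambda>(z, t::nat). \<not> stop z)"
  define g where "g = (\<lambda>(z, t::nat). let w = u (P z) in (z + step_size P z w *\<^sub>R (w - z), t + 1))"
  define I where "I = (\<lambda>(z, t::nat). z \<in> spectraplex \<and> (real t + 1) * jinner (P z) (P z) \<le> 1 \<and> t \<le> N)"
  have step: "I (g s) \<and> N - snd (g s) < N - snd s" if I: "I s" and "b s" for s
  proof -
    obtain z t where s: "s = (z, t)" by (cases s)
    define a where "a = jinner (P z) (P z)"
    have z: "z \<in> spectraplex" "(real t + 1) * a \<le> 1" and "\<not> stop z"
      using that by (simp_all add: I_def b_def s a_def)
    with stop have "P z \<notin> Omega" and N: "1 < N * a" by (auto simp: a_def)
    define w where "w = u (P z)"
    have w: "w \<in> spectraplex" "jinner w (P z) \<le> 0"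
      using spectraplex_minimizer_nonpos[OF u \<open>P z \<notin> Omega\<close>] by (simp_all add: w_def)
    have a: "0 < a" using N trace.form_nonneg[of "P z"] by (cases "a = 0") (auto simp: a_def)
    define z' where "z' = z + step_size P z w *\<^sub>R (w - z)"
    have gs: "g s = (z', t + 1)" by (simp add: g_def s z'_def w_def Let_def)
    note st = step_size_bound[OF P w a[unfolded a_def], folded a_def z'_def]
    have z': "z' \<in> spectraplex"
      unfolding z'_def by (rule spectraplex_convex[OF z(1) w(1) st(1,2)])
    have "(real t + 2) * jinner (P z') (P z') \<le> (real t + 2) * (a / (1 + a))"
      using st(3) by (intro mult_left_mono) auto
    also have "\<dots> \<le> 1" using z(2) a by (simp add: field_simps)
    finally have "(real t + 2) * jinner (P z') (P z') \<le> 1" .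
    \<comment> \<open>The invariant and the failed stopping test give \<open>t + 1 < N\<close>: the
      counter stays within the bound and the measure drops.\<close>
    moreover have "(real t + 1) * a < N * a" using z(2) N by linarith
    then have "t + 1 < N" using a by (simp add: mult_less_cancel_right)
    ultimately show ?thesis
      using z' unfolding gs unfolding s by (simp add: I_def algebra_simps)
  qed
  have I0: "I (z0, 0)"
    using z0 orthogonal_projection(3)[OF P, of z0] spectraplex_jinner_le_1[OF z0] by (simp add: I_def)
  have "\<exists>s. while_option b g (z0, 0) = Some s"
    by (rule measure_while_option_Some[where P = I and f = "\<lambda>s. N - snd s"]) (use step I0 in auto)
  then obtain s where s: "while_option b g (z0, 0) = Some s" by blast
  have "I s" by (rule while_option_rule[where P = I, OF _ s]) (use step I0 in auto)
  moreover have "\<not> b s" using while_option_stop[OF s] .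
  moreover have "von_neumann_scheme P u stop z0 = Some s"
    using s by (simp add: von_neumann_scheme_def b_def g_def)
  ultimately show ?thesis by (cases s) (auto simp: I_def b_def)
qed

end

context euclidean_jordan_algebra
begin

text \<open>Since \<open>spec_norm z\<close> is at least \<open>1 / r\<close>, a failed norm test
  forces \<open>frob_norm (P z) > 1 / (4 r^2)\<close>; squaring produces
  \<open>16 r^4\<close>.\<close>

lemma not_stopping:
  assumes "z \<in> spectraplex" "\<not> stopping P z"
  shows "P z \<notin> Omega \<and> 1 < real (16 * jrank ^ 4) * jinner (P z) (P z)"
proof -
  let ?r = "real jrank"
  have r: "0 < ?r" using jrank_pos by simp
  have "P z \<notin> Omega" and lt: "1 / (4 * ?r) * spec_norm z < frob_norm (pos_part (P z))"
    using assms(2) by (auto simp: stopping_def)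
  have "1 / (4 * ?r) * (1 / ?r) \<le> 1 / (4 * ?r) * spec_norm z"
    using spectraplex_spec_norm[OF assms(1)] r by (intro mult_left_mono) auto
  also have "\<dots> < frob_norm (P z)" using lt frob_norm_pos_part[of "P z"] by linarith
  finally have "(1 / (4 * ?r) * (1 / ?r))\<^sup>2 < (frob_norm (P z))\<^sup>2"
    using r by (intro power_strict_mono) auto
  moreover have "(1 / (4 * ?r) * (1 / ?r))\<^sup>2 = 1 / real (16 * jrank ^ 4)"
    by (simp add: power2_eq_square power4_eq_xxxx)
  ultimately have "1 / real (16 * jrank ^ 4) < jinner (P z) (P z)"
    by (simp only: frob_norm_square)
  then have "1 < real (16 * jrank ^ 4) * jinner (P z) (P z)"
    using r by (simp add: field_simps)
  with \<open>P z \<notin> Omega\<close> show ?thesis by blast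
qed

end

subsection \<open>The orthant\<close>

lemma euclidean_jordan_algebra_cw_mult:
  "euclidean_jordan_algebra (cw_mult :: real ^ 'n \<Rightarrow> _) ones"
proof
  show "bilinear (cw_mult :: real ^ 'n \<Rightarrow> _)"
    by (auto simp: bilinear_def vec_eq_iff algebra_simps intro!: linearI)
  show "\<exists>B :: real ^ 'n \<Rightarrow> real ^ 'n \<Rightarrow> real. bilinear B \<and>
      (\<forall>x y z. B (cw_mult x y) z = B x (cw_mult y z)) \<and> (\<forall>x. x \<noteq> 0 \<longrightarrow> 0 < B x x)"
  proof (intro exI conjI allI impI)
    show "bilinear ((\<bullet>) :: real ^ 'n \<Rightarrow> _)"
      by (simp add: bilinear_conv_bounded_bilinear bounded_bilinear_inner)
    show "0 < x \<bullet> x" if "x \<noteq> 0" for x :: "real ^ 'n" using that by simp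
  qed (simp add: inner_vec_def algebra_simps)
qed (simp_all add: vec_eq_iff algebra_simps)

interpretation orthant: euclidean_jordan_algebra "cw_mult :: real ^ 'n \<Rightarrow> _" ones
  by (rule euclidean_jordan_algebra_cw_mult)

lemma primitive_idempotent_axis: "orthant.primitive_idempotent (axis i 1 :: real ^ 'n)"
  unfolding orthant.primitive_idempotent_def orthant.idempotent_def
proof (intro conjI notI)
  assume "\<exists>a b. a \<noteq> 0 \<and> b \<noteq> 0 \<and> cw_mult a a = a \<and> cw_mult b b = b \<and> (axis i 1 :: real ^ 'n) = a + b"
  then obtain a b :: "real ^ 'n" where ab: "a \<noteq> 0" "b \<noteq> 0" "axis i 1 = a + b"
    and "\<And>j. a $ j * a $ j = a $ j" "\<And>j. b $ j * b $ j = b $ j"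
    by (metis (no_types, lifting) vec_lambda_beta)
  then have v: "a $ j = 0 \<or> a $ j = 1" "b $ j = 0 \<or> b $ j = 1" for j
    by (metis mult_cancel_right2)+
  have s: "a $ j + b $ j = (if j = i then 1 else 0)" for j
    using arg_cong[OF ab(3), of "\<lambda>x. x $ j"] by (simp add: axis_def)
  have z: "a $ j = 0" "b $ j = 0" if "j \<noteq> i" for j
    using v[of j] s[of j] that by auto
  \<comment> \<open>Entries of idempotents are 0 or 1, and two entries 1 would sum to 2.\<close>
  have "a $ i = 0 \<or> b $ i = 0" using v[of i] s[of i] by auto
  then have "a = 0 \<or> b = 0" using z by (metis vec_eq_iff zero_index)
  then show False using ab by blast
qed (auto simp: axis_eq_0_iff, simp add: axis_def vec_eq_iff)

text \<open>Linearity and the value 1 on the primitive idempotents \<open>axis i 1\<close> determine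
  the trace.\<close>

lemma orthant_jtrace: "orthant.jtrace x = (\<Sum>i\<in>UNIV. x $ i)"
proof -
  have "x = (\<Sum>i\<in>UNIV. x $ i *\<^sub>R axis i 1)"
    using basis_expansion[of x] by (simp add: scalar_mult_eq_scaleR)
  then have "orthant.jtrace x = (\<Sum>i\<in>UNIV. x $ i * orthant.jtrace (axis i 1))"
    using linear_sum[OF orthant.linear_jtrace, of "\<lambda>i. x $ i *\<^sub>R axis i 1" UNIV]
    by (simp add: linear_scale[OF orthant.linear_jtrace])
  then show ?thesis by (simp add: orthant.jtrace_primitive[OF primitive_idempotent_axis])
qed

lemma orthant_jinner: "orthant.jinner x y = x \<bullet> y"
  by (simp add: orthant.jinner_def orthant_jtrace inner_vec_def)

lemma orthant_Omega_pos:
  assumes "x \<in> orthant.Omega"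
  shows "0 < x $ i"
proof -
  obtain d where d: "d > 0" "cball x d \<subseteq> {cw_mult y y | y. True}"
    using assms unfolding orthant.Omega_def mem_interior_cball by blast
  \<comment> \<open>Moving by \<open>d\<close> against the axis stays among the squares, so
    \<open>x $ i - d\<close> is itself a square.\<close>
  have "x - d *\<^sub>R axis i 1 \<in> cball x d" using d(1) by (simp add: dist_norm norm_axis_1)
  then obtain y where "x - d *\<^sub>R axis i 1 = cw_mult y y" using d(2) by blast
  from arg_cong[OF this, of "\<lambda>v. v $ i"] have "x $ i - d = y $ i * y $ i"
    by (simp add: axis_def)
  then show ?thesis using d(1) zero_le_square[of "y $ i"] by linarith
qed

lemma orthant_spectraplex_infnorm:
  fixes z :: "real ^ 'n"
  assumes "z \<in> orthant.spectraplex"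
  shows "1 / real CARD('n) \<le> infnorm z"
proof -
  have "1 = (\<Sum>i\<in>UNIV. z $ i)" using assms by (simp add: orthant.mem_spectraplex orthant_jtrace)
  also have "\<dots> \<le> (\<Sum>i\<in>(UNIV :: 'n set). infnorm z)"
    by (intro sum_mono order_trans[OF abs_ge_self component_le_infnorm_cart])
  finally show ?thesis by (simp add: field_simps)
qed

text \<open>Here \<open>infnorm z\<close> is at least \<open>1 / n\<close>, so a failed norm test
  gives \<open>norm (P z) > 1 / (3 n sqrt n)\<close>, whose square is
  \<open>1 / (9 n^3)\<close>.\<close>

lemma not_orthant_stopping:
  fixes z :: "real ^ 'n"
  assumes z: "z \<in> orthant.spectraplex" and stop: "\<not> orthant_stopping P z"
  shows "P z \<notin> orthant.Omega \<and> 1 < real (9 * CARD('n) ^ 3) * orthant.jinner (P z) (P z)"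
proof -
  let ?n = "real CARD('n)"
  obtain i where "\<not> 0 < P z $ i" using stop by (auto simp: orthant_stopping_def)
  then have "P z \<notin> orthant.Omega" using orthant_Omega_pos by blast
  have "1 / (3 * sqrt ?n) * (1 / ?n) \<le> 1 / (3 * sqrt ?n) * infnorm z"
    using orthant_spectraplex_infnorm[OF z] by (intro mult_left_mono) auto
  also have "\<dots> < norm (\<chi> i. max (P z $ i) 0)"
    using stop by (simp add: orthant_stopping_def)
  also have "\<dots> \<le> norm (P z)"
    by (rule norm_le_componentwise_cart) auto
  finally have "(1 / (3 * sqrt ?n) * (1 / ?n))\<^sup>2 < (norm (P z))\<^sup>2"
    by (intro power_strict_mono) auto
  moreover have "(1 / (3 * sqrt ?n) * (1 / ?n))\<^sup>2 = 1 / real (9 * CARD('n) ^ 3)"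
    by (simp add: power_mult_distrib power_divide power3_eq_cube power2_eq_square)
  ultimately have "1 / real (9 * CARD('n) ^ 3) < orthant.jinner (P z) (P z)"
    by (simp only: orthant_jinner power2_norm_eq_inner)
  then have "1 < real (9 * CARD('n) ^ 3) * orthant.jinner (P z) (P z)"
    by (simp add: field_simps)
  with \<open>P z \<notin> orthant.Omega\<close> show ?thesis by blast
qed

theorem corollary2:
  shows
    "(\<forall>(jp :: 'a::euclidean_space \<Rightarrow> 'a \<Rightarrow> 'a) e L P u z0.
        euclidean_jordan_algebra jp e \<longrightarrow>
        jordan_product.orthogonal_projection_onto jp e L P \<longrightarrow>
        jordan_product.spectraplex_minimizer jp e u \<longrightarrow>
        z0 \<in> jordan_product.spectraplex jp e \<longrightarrow>
        (\<exists>z t. jordan_product.von_neumann_scheme jp e P u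
                 (jordan_product.stopping jp e P) z0 = Some (z, t) \<and>
               jordan_product.stopping jp e P z \<and>
               t \<le> 16 * jordan_product.jrank jp e ^ 4))
     \<and>
     (\<forall>(L :: (real ^ 'n) set) P u z0.
        jordan_product.orthogonal_projection_onto cw_mult ones L P \<longrightarrow>
        jordan_product.spectraplex_minimizer cw_mult ones u \<longrightarrow>
        z0 \<in> jordan_product.spectraplex cw_mult ones \<longrightarrow>
        (\<exists>z t. jordan_product.von_neumann_scheme cw_mult ones P u
                 (orthant_stopping P) z0 = Some (z, t) \<and>
               orthant_stopping P z \<and>
               t \<le> 9 * CARD('n) ^ 3))"
proof (intro conjI allI impI)
  fix jp :: "'a \<Rightarrow> 'a \<Rightarrow> 'a" and e L P u z0
  assume "euclidean_jordan_algebra jp e"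
  then interpret euclidean_jordan_algebra jp e .
  assume "orthogonal_projection_onto L P" "spectraplex_minimizer u" "z0 \<in> spectraplex"
  from von_neumann_scheme_terminates[OF this not_stopping[where P = P]]
  show "\<exists>z t. von_neumann_scheme P u (stopping P) z0 = Some (z, t) \<and> stopping P z \<and> t \<le> 16 * jrank ^ 4" .
next
  fix L :: "(real ^ 'n) set" and P u :: "real ^ 'n \<Rightarrow> real ^ 'n" and z0 :: "real ^ 'n"
  assume "orthant.orthogonal_projection_onto L P" "orthant.spectraplex_minimizer u" "z0 \<in> orthant.spectraplex"
  from orthant.von_neumann_scheme_terminates[OF this not_orthant_stopping[where P = P]]
  show "\<exists>z t. orthant.von_neumann_scheme P u (orthant_stopping P) z0 = Some (z, t) \<and>
      orthant_stopping P z \<and> t \<le> 9 * CARD('n) ^ 3" .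
qed

end
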